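(* Let $\mathscr{C}\in\{\mathrm{FA},\mathrm{OA},\mathrm{CA},\mathrm{BA},\mathrm{SA}\}$ and let $k$ be a commutative ring. If $k$ is noetherian, then every finitely generated $\mathscr{C}$-module over $k$ is noetherian. If $k$ is artinian, then every finitely generated $\mathscr{C}$-module over $k$ has finite length.
   Context: For $n\geq1$ put $[n]=\{1,\dots,n\}$. All five categories have objects $[n]$, $n\in\mathbb{Z}_{+}=\{1,2,\dots\}$, and morphisms: $\mathrm{FA}$: all maps; $\mathrm{OA}$ (simplex category): weakly order-preserving maps; $\mathrm{CA}$: maps preserving the cyclic order, i.e. maps $\sigma\circ g\circ\rho$ with $\rho,\sigma$ rotations (powers of the standard cyclic permutation) of source and target and $g$ weakly order-preserving; $\mathrm{BA}$: maps preserving linear betweenness, i.e. weakly order-preserving or weakly order-reversing maps; $\mathrm{SA}$: maps preserving the separation relation, i.e. maps $f:[m]\to[n]$ such that $f$ or its composite with the reversal $i\mapsto n+1-i$ of $[n]$ lies in $\mathrm{CA}$. A $\mathscr{C}$-module is a covariant functor $\mathscr{C}\to k\text{-}\mathrm{Mod}$; it is finitely generated if it is a quotient of a finite direct sum of representable functors $k\mathscr{C}(n,-)$, where $k\mathscr{C}(n,m)$ is the free $k$-module on the morphisms $[n]\to[m]$. *)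

theory Defs
  imports "HOL-Algebra.Algebra"
begin

section \<open>The five categories\<close>

text \<open>
  The objects are the sets {1..n} with n > 0. A category is given by its morphism sets
  C m n :: (nat => nat) set; a morphism is an extensional function on {1..m}, so that equality
  of morphisms is HOL equality. The composite of f : [l] -> [m] with g : [m] -> [n] is
  compose {1..l} g f, and the identity of [n] is restrict id {1..n}.
\<close>

type_synonym category = "nat \<Rightarrow> nat \<Rightarrow> (nat \<Rightarrow> nat) set"

definition FA :: category where
  "FA m n = {1..m} \<rightarrow>\<^sub>E {1..n}"

definition OA :: category where
  "OA m n = {f \<in> FA m n. mono_on {1..m} f}"

definition rot :: "nat \<Rightarrow> nat \<Rightarrow> nat" where
  "rot n i = (if i = n then 1 else i + 1)"

definition CA :: category where
  "CA m n = {compose {1..m} (rot n ^^ j) (compose {1..m} g (rot m ^^ i)) | i j g. g \<in> OA m n}"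

definition BA :: category where
  "BA m n = {f \<in> FA m n. mono_on {1..m} f \<or> monotone_on {1..m} (\<le>) (\<ge>) f}"

definition reversal :: "nat \<Rightarrow> nat \<Rightarrow> nat" where
  "reversal n i = n + 1 - i"

definition SA :: category where
  "SA m n = {f \<in> FA m n. f \<in> CA m n \<or> compose {1..m} (reversal n) f \<in> CA m n}"


section \<open>Modules over a category\<close>

definition linear_map ::
    "('a, 'r) ring_scheme \<Rightarrow> ('a, 'b) module \<Rightarrow> ('a, 'c) module \<Rightarrow> ('b \<Rightarrow> 'c) \<Rightarrow> bool" where
  "linear_map R M N f \<longleftrightarrow>
     f \<in> carrier M \<rightarrow> carrier N \<and>
     (\<forall>x\<in>carrier M. \<forall>y\<in>carrier M. f (x \<oplus>\<^bsub>M\<^esub> y) = f x \<oplus>\<^bsub>N\<^esub> f y) \<and>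
     (\<forall>a\<in>carrier R. \<forall>x\<in>carrier M. f (a \<odot>\<^bsub>M\<^esub> x) = a \<odot>\<^bsub>N\<^esub> f x)"

text \<open>
  Only the values at objects n > 0, and those of act m n f at morphisms f in C m n, are
  meaningful; everything below ignores the other values.
\<close>

record ('a, 'b) cat_functor =
  obj :: "nat \<Rightarrow> ('a, 'b) module"
  act :: "nat \<Rightarrow> nat \<Rightarrow> (nat \<Rightarrow> nat) \<Rightarrow> 'b \<Rightarrow> 'b"

locale cat_module =
  fixes R :: "('a, 'r) ring_scheme" and C :: category and M :: "('a, 'b) cat_functor"
  assumes obj_module: "n > 0 \<Longrightarrow> module R (obj M n)"
    and act_linear: "\<lbrakk>m > 0; n > 0; f \<in> C m n\<rbrakk> \<Longrightarrow> linear_map R (obj M m) (obj M n) (act M m n f)"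
    and act_id: "\<lbrakk>n > 0; x \<in> carrier (obj M n)\<rbrakk> \<Longrightarrow> act M n n (restrict id {1..n}) x = x"
    and act_comp: "\<lbrakk>l > 0; m > 0; n > 0; f \<in> C l m; g \<in> C m n; x \<in> carrier (obj M l)\<rbrakk> \<Longrightarrow>
      act M l n (compose {1..l} g f) x = act M m n g (act M l m f x)"

definition cat_module_hom ::
    "('a, 'r) ring_scheme \<Rightarrow> category \<Rightarrow> ('a, 'b) cat_functor \<Rightarrow> ('a, 'c) cat_functor \<Rightarrow>
     (nat \<Rightarrow> 'b \<Rightarrow> 'c) \<Rightarrow> bool" where
  "cat_module_hom R C M N \<phi> \<longleftrightarrow>
     (\<forall>n>0. linear_map R (obj M n) (obj N n) (\<phi> n)) \<and>
     (\<forall>m>0. \<forall>n>0. \<forall>f\<in>C m n. \<forall>x\<in>carrier (obj M m). \<phi> n (act M m n f x) = act N m n f (\<phi> m x))"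

text \<open>
  The functor kC(d,-). An element of the free module on the finite set C d n is the extensional
  function of its coefficients; a morphism g acts by h |-> g o h on basis elements. The fields
  mult and one of a module record carry no meaning.
\<close>

definition representable ::
    "('a, 'r) ring_scheme \<Rightarrow> category \<Rightarrow> nat \<Rightarrow> ('a, (nat \<Rightarrow> nat) \<Rightarrow> 'a) cat_functor" where
  "representable R C d = \<lparr>
     obj = (\<lambda>n. \<lparr>
       carrier = C d n \<rightarrow>\<^sub>E carrier R,
       monoid.mult = undefined,
       monoid.one = undefined,
       ring.zero = (\<lambda>h\<in>C d n. \<zero>\<^bsub>R\<^esub>),
       ring.add = (\<lambda>x y. \<lambda>h\<in>C d n. x h \<oplus>\<^bsub>R\<^esub> y h),
       smult = (\<lambda>a x. \<lambda>h\<in>C d n. a \<otimes>\<^bsub>R\<^esub> x h)\<rparr>),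
     act = (\<lambda>m n g x. \<lambda>h\<in>C d n. \<Oplus>\<^bsub>R\<^esub>h'\<in>{h' \<in> C d m. compose {1..d} g h' = h}. x h')\<rparr>"

definition direct_sum :: "nat \<Rightarrow> (nat \<Rightarrow> ('a, 'b) cat_functor) \<Rightarrow> ('a, nat \<Rightarrow> 'b) cat_functor" where
  "direct_sum r M = \<lparr>
     obj = (\<lambda>n. \<lparr>
       carrier = (\<Pi>\<^sub>E i\<in>{..<r}. carrier (obj (M i) n)),
       monoid.mult = undefined,
       monoid.one = undefined,
       ring.zero = (\<lambda>i\<in>{..<r}. \<zero>\<^bsub>obj (M i) n\<^esub>),
       ring.add = (\<lambda>x y. \<lambda>i\<in>{..<r}. x i \<oplus>\<^bsub>obj (M i) n\<^esub> y i),
       smult = (\<lambda>a x. \<lambda>i\<in>{..<r}. a \<odot>\<^bsub>obj (M i) n\<^esub> x i)\<rparr>),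
     act = (\<lambda>m n g x. \<lambda>i\<in>{..<r}. act (M i) m n g (x i))\<rparr>"

definition finitely_generated ::
    "('a, 'r) ring_scheme \<Rightarrow> category \<Rightarrow> ('a, 'b) cat_functor \<Rightarrow> bool" where
  "finitely_generated R C M \<longleftrightarrow>
     (\<exists>r d \<pi>. (\<forall>i<r. d i > 0) \<and>
       cat_module_hom R C (direct_sum r (\<lambda>i. representable R C (d i))) M \<pi> \<and>
       (\<forall>n>0. \<pi> n ` carrier (obj (direct_sum r (\<lambda>i. representable R C (d i))) n) = carrier (obj M n)))"


section \<open>Chain conditions\<close>

definition cat_submodule ::
    "('a, 'r) ring_scheme \<Rightarrow> category \<Rightarrow> ('a, 'b) cat_functor \<Rightarrow> (nat \<Rightarrow> 'b set) \<Rightarrow> bool" where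
  "cat_submodule R C M N \<longleftrightarrow>
     (\<forall>n>0. submodule (N n) R (obj M n)) \<and>
     (\<forall>m>0. \<forall>n>0. \<forall>f\<in>C m n. act M m n f ` N m \<subseteq> N n)"

definition sub_le :: "(nat \<Rightarrow> 'b set) \<Rightarrow> (nat \<Rightarrow> 'b set) \<Rightarrow> bool" where
  "sub_le N N' \<longleftrightarrow> (\<forall>n>0. N n \<subseteq> N' n)"

definition noetherian_module ::
    "('a, 'r) ring_scheme \<Rightarrow> category \<Rightarrow> ('a, 'b) cat_functor \<Rightarrow> bool" where
  "noetherian_module R C M \<longleftrightarrow>
     (\<forall>N. (\<forall>i::nat. cat_submodule R C M (N i)) \<and> (\<forall>i. sub_le (N i) (N (Suc i))) \<longrightarrow>
       (\<exists>i\<^sub>0. \<forall>i\<ge>i\<^sub>0. sub_le (N i) (N i\<^sub>0)))"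

text \<open>The length of a module is the supremum of the lengths l of its strict chains N 0 < N 1 < ... < N l.\<close>

definition finite_length ::
    "('a, 'r) ring_scheme \<Rightarrow> category \<Rightarrow> ('a, 'b) cat_functor \<Rightarrow> bool" where
  "finite_length R C M \<longleftrightarrow>
     (\<exists>L. \<forall>l N. (\<forall>i\<le>l. cat_submodule R C M (N i)) \<and>
        (\<forall>i<l. sub_le (N i) (N (Suc i)) \<and> \<not> sub_le (N (Suc i)) (N i)) \<longrightarrow> l \<le> (L::nat))"

locale artinian_ring = ring +
  assumes descending_chain: "\<lbrakk>\<And>i::nat. ideal (I i) R; \<And>i. I (Suc i) \<subseteq> I i\<rbrakk> \<Longrightarrow>
    \<exists>i\<^sub>0. \<forall>i\<ge>i\<^sub>0. I i = I i\<^sub>0"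

end

theory Submission
  imports Defs
begin

text \<open>
  All five categories lie between OA and FA, and only the action of OA is needed. On M(n) consider the
  operator T = (1 - e_{n-1}) ... (1 - e_1), where e_j maps j + 1 to j and fixes every other point. If
  h : [d] -> [n] misses j + 1, then (e_j) h = h, and every e_i with i < j preserves the vectors fixed by
  e_j; hence T h = 0 as soon as n \<ge> d + 2. So T = 0 on M(n) once n is large compared with the degrees of
  the generators. Each e_j factors through [n-1], so x = x - T x shows that a submodule N is determined
  among the submodules by its values N(n) for n below a fixed bound D. This reduces both claims to the
  finitely many finitely generated k-modules M(1), ..., M(D-1). The chain conditions pass from k to these
  by adjoining one generator at a time, using the modular law; for artinian k the needed statement is that
  k has finite length over itself.
\<close>

section \<open>Chains with few strict steps\<close>

text \<open>The order of the factors of T is forced. If i < j, then e_i applied after e_j does not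
  bring back the value j + 1, so being fixed by e_j survives until the factor 1 - e_j is reached;
  e_{j+1} would send j + 2 to j + 1 and destroy it. The two claims share the whole reduction but
  differ in their input on k. The noetherian condition says directly that chains of ideals stop. The
  artinian condition concerns descending chains, whereas finite length asks for one bound on the
  strict steps of all chains, so that bound has to be built first. Hence the bookkeeping is by sets
  of strict steps: they can be covered degree by degree and layer by layer, whether they are counted
  or only known to be finite.\<close>

definition strict_steps :: "(nat \<Rightarrow> 'a) \<Rightarrow> nat set" where
  "strict_steps N = {i. N i \<noteq> N (Suc i)}"

text \<open>
  The flag u selects the chain condition: finitely many strict steps in every chain (u = False),
  or a bound on the number of steps that is uniform over all chains (u = True).
\<close>

definition bounded_family :: "bool \<Rightarrow> nat set set \<Rightarrow> bool" where
  "bounded_family u F \<longleftrightarrow> (\<forall>S\<in>F. finite S) \<and> (u \<longrightarrow> (\<exists>L. \<forall>S\<in>F. card S \<le> L))"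

text \<open>The lattice stays abstract because it is used both for the ideals of R and for the
  submodules of each M(n). For \<open>u = True\<close> the condition says that the interval from A
  to B has finite length; finite chains are included by repeating their last term.\<close>

definition short_interval :: "bool \<Rightarrow> 'a set set \<Rightarrow> 'a set \<Rightarrow> 'a set \<Rightarrow> bool" where
  "short_interval u \<S> A B \<longleftrightarrow>
     bounded_family u (strict_steps ` {N. incseq N \<and> (\<forall>i. N i \<in> \<S> \<and> A \<subseteq> N i \<and> N i \<subseteq> B)})"

text \<open>Subadditivity of length: the strict steps of a chain are spread over finitely many
  auxiliary chains, and the bounds add up. This serves for the layers of an interval and for the
  degrees below D.\<close>

lemma bounded_family_UN:
  assumes "finite I" and F: "\<And>i. i \<in> I \<Longrightarrow> bounded_family u (F i)"
    and cover: "\<And>S. S \<in> G \<Longrightarrow> \<exists>s. (\<forall>i\<in>I. s i \<in> F i) \<and> S \<subseteq> (\<Union>i\<in>I. s i)"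
  shows "bounded_family u G"
proof -
  have fin: "finite (\<Union>i\<in>I. s i)" if "\<forall>i\<in>I. s i \<in> F i" for s
    using that F \<open>finite I\<close> by (auto simp: bounded_family_def)
  have "finite S" if "S \<in> G" for S
    using cover[OF that] fin finite_subset by blast
  moreover have "\<exists>L. \<forall>S\<in>G. card S \<le> L" if u
  proof -
    obtain L where L: "\<And>i S. i \<in> I \<Longrightarrow> S \<in> F i \<Longrightarrow> card S \<le> L i"
      using F \<open>u\<close> unfolding bounded_family_def by metis
    have "card S \<le> (\<Sum>i\<in>I. L i)" if S: "S \<in> G" for S
    proof -
      obtain s where s: "\<forall>i\<in>I. s i \<in> F i" "S \<subseteq> (\<Union>i\<in>I. s i)"
        using cover[OF S] by blast
      have "card S \<le> card (\<Union>i\<in>I. s i)"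
        using s fin card_mono by blast
      also have "\<dots> \<le> (\<Sum>i\<in>I. card (s i))"
        by (rule card_UN_le[OF \<open>finite I\<close>])
      also have "\<dots> \<le> (\<Sum>i\<in>I. L i)"
        using L s by (intro sum_mono) auto
      finally show ?thesis .
    qed
    then show ?thesis by blast
  qed
  ultimately show ?thesis by (auto simp: bounded_family_def)
qed

lemma bounded_family_Un:
  assumes "bounded_family u F1" "bounded_family u F2"
    and "\<And>S. S \<in> G \<Longrightarrow> \<exists>S1\<in>F1. \<exists>S2\<in>F2. S \<subseteq> S1 \<union> S2"
  shows "bounded_family u G"
proof (rule bounded_family_UN[of "UNIV :: bool set" u "\<lambda>b. if b then F1 else F2"])
  fix S assume "S \<in> G"
  then obtain S1 S2 where "S1 \<in> F1" "S2 \<in> F2" "S \<subseteq> S1 \<union> S2" using assms(3) by blast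
  then show "\<exists>s. (\<forall>b\<in>UNIV. s b \<in> (if b then F1 else F2)) \<and> S \<subseteq> (\<Union>b\<in>UNIV. s b)"
    by (intro exI[of _ "\<lambda>b. if b then S1 else S2"]) (auto simp: UNIV_bool)
qed (use assms in auto)

text \<open>A monotone map that separates comparable members keeps every strict step strict, so the
  source interval is no longer than the target.\<close>

lemma short_interval_transfer:
  assumes short: "short_interval u \<T> A' B'"
    and mono: "mono_on {C \<in> \<S>. A \<subseteq> C \<and> C \<subseteq> B} \<Phi>"
    and closed: "\<And>C. C \<in> \<S> \<Longrightarrow> A \<subseteq> C \<Longrightarrow> C \<subseteq> B \<Longrightarrow> \<Phi> C \<in> \<T> \<and> A' \<subseteq> \<Phi> C \<and> \<Phi> C \<subseteq> B'"
    and inj: "\<And>C D. \<lbrakk>C \<in> \<S>; D \<in> \<S>; A \<subseteq> C; C \<subseteq> D; D \<subseteq> B; \<Phi> C = \<Phi> D\<rbrakk> \<Longrightarrow> D \<subseteq> C"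
  shows "short_interval u \<S> A B"
  unfolding short_interval_def
\<comment> \<open>The same family is taken twice: one image chain already has all the strict steps,
  and the rule only passes to subsets of step sets.\<close>
proof (rule bounded_family_Un[OF short[unfolded short_interval_def] short[unfolded short_interval_def]])
  fix S assume "S \<in> strict_steps ` {N. incseq N \<and> (\<forall>i. N i \<in> \<S> \<and> A \<subseteq> N i \<and> N i \<subseteq> B)}"
  then obtain N where N: "incseq N" "\<And>i. N i \<in> \<S>" "\<And>i. A \<subseteq> N i" "\<And>i. N i \<subseteq> B"
    and S: "S = strict_steps N" by auto
  have "incseq (\<lambda>i. \<Phi> (N i))"
    unfolding incseq_def using N mono_onD[OF mono] by (simp add: incseqD)
  moreover have "S \<subseteq> strict_steps (\<lambda>i. \<Phi> (N i))"
  proof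
    fix i assume "i \<in> S"
    moreover have "N i \<subseteq> N (Suc i)" using N(1) by (simp add: incseqD)
    ultimately show "i \<in> strict_steps (\<lambda>i. \<Phi> (N i))"
      using inj[of "N i" "N (Suc i)"] N(2-4) unfolding S strict_steps_def by blast
  qed
  ultimately show "\<exists>S1\<in>strict_steps ` {N. incseq N \<and> (\<forall>i. N i \<in> \<T> \<and> A' \<subseteq> N i \<and> N i \<subseteq> B')}.
        \<exists>S2\<in>strict_steps ` {N. incseq N \<and> (\<forall>i. N i \<in> \<T> \<and> A' \<subseteq> N i \<and> N i \<subseteq> B')}. S \<subseteq> S1 \<union> S2"
    using closed N by (intro bexI[of _ "strict_steps (\<lambda>i. \<Phi> (N i))"]) auto
qed

text \<open>Used for simple layers, and with A = B as the start of inductions.\<close>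

lemma short_interval_two:
  assumes two: "\<And>C. C \<in> \<S> \<Longrightarrow> A \<subseteq> C \<Longrightarrow> C \<subseteq> B \<Longrightarrow> C = A \<or> C = B"
  shows "short_interval u \<S> A B"
proof -
  have "finite (strict_steps N) \<and> card (strict_steps N) \<le> 1"
    if N: "incseq N" "\<And>i. N i \<in> \<S> \<and> A \<subseteq> N i \<and> N i \<subseteq> B" for N
  proof -
    have "\<exists>k. strict_steps N \<subseteq> {k}"
    proof (cases "strict_steps N = {}")
      case False
      then obtain k where k: "N k \<noteq> N (Suc k)" by (auto simp: strict_steps_def)
      have ends: "N i = A \<or> N i = B" for i using two N by blast
      have "N k \<subseteq> N (Suc k)" using N(1) by (simp add: incseqD)
      then have "N k = A" "N (Suc k) = B" using k ends[of k] ends[of "Suc k"] N(2)[of k] by auto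
      have "i = k" if "N i \<noteq> N (Suc i)" for i
      proof (rule ccontr)
        assume "i \<noteq> k"
        then consider "Suc i \<le> k" | "Suc k \<le> i" by linarith
        then show False
        proof cases
          case 1
          then have "N i \<subseteq> A" "N (Suc i) \<subseteq> A"
            using N(1) \<open>N k = A\<close> by (metis Suc_leD incseqD)+
          then show False using N(2) that by blast
        next
          case 2
          then have "B \<subseteq> N i" "B \<subseteq> N (Suc i)"
            using N(1) \<open>N (Suc k) = B\<close> by (metis incseqD le_Suc_eq)+
          then show False using N(2) that by blast
        qed
      qed
      then show ?thesis by (auto simp: strict_steps_def)
    qed auto
    then obtain k where k: "strict_steps N \<subseteq> {k}" by blast
    then show ?thesis using card_mono[OF _ k] finite_subset[OF k] by simp
  qed
  then show ?thesis
    unfolding short_interval_def bounded_family_def by blast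
qed

lemma (in abelian_monoid) mem_set_add:
  "z \<in> H <+>\<^bsub>G\<^esub> K \<longleftrightarrow> (\<exists>h\<in>H. \<exists>k\<in>K. z = h \<oplus> k)"
  by (auto simp: set_add_defs)

text \<open>Additivity of length over two layers: a chain N is traced in the lower layer by N
  \<inter> B and in the upper one by N + B. By the modular law, comparable members with equal traces
  coincide.\<close>

lemma (in abelian_group) short_interval_trans:
  assumes sub: "\<And>H. H \<in> \<S> \<Longrightarrow> additive_subgroup H G"
    and Int: "\<And>H K. H \<in> \<S> \<Longrightarrow> K \<in> \<S> \<Longrightarrow> H \<inter> K \<in> \<S>"
    and Add: "\<And>H K. H \<in> \<S> \<Longrightarrow> K \<in> \<S> \<Longrightarrow> H <+>\<^bsub>G\<^esub> K \<in> \<S>"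
    and B: "B \<in> \<S>" "A \<subseteq> B" "B \<subseteq> C"
    and short: "short_interval u \<S> A B" "short_interval u \<S> B C"
    and "C \<in> \<S>"
  shows "short_interval u \<S> A C"
  unfolding short_interval_def
proof (rule bounded_family_Un[OF short[unfolded short_interval_def]])
  fix S assume "S \<in> strict_steps ` {N. incseq N \<and> (\<forall>i. N i \<in> \<S> \<and> A \<subseteq> N i \<and> N i \<subseteq> C)}"
  then obtain N where N: "incseq N" "\<And>i. N i \<in> \<S>" "\<And>i. A \<subseteq> N i" "\<And>i. N i \<subseteq> C"
    and S: "S = strict_steps N" by auto
  have le: "N i \<subseteq> N (Suc i)" for i using N(1) by (simp add: incseqD)
  have carr: "H \<subseteq> carrier G" if "H \<in> \<S>" for H
    using additive_subgroup.a_subset sub that by blast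
  let ?N1 = "\<lambda>i. N i \<inter> B" and ?N2 = "\<lambda>i. N i <+>\<^bsub>G\<^esub> B"
  have "incseq ?N1" using N(1) by (auto simp: incseq_def)
  moreover have "?N1 i \<in> \<S>" "A \<subseteq> ?N1 i" "?N1 i \<subseteq> B" for i using N B Int by auto
  moreover have "incseq ?N2" using N(1) unfolding incseq_def subset_iff mem_set_add by blast
  moreover have "?N2 i \<in> \<S>" for i using N B Add by auto
  moreover have "B \<subseteq> ?N2 i" for i
  proof
    fix b assume "b \<in> B"
    then have "b = \<zero> \<oplus> b" using carr[OF B(1)] by (simp add: subset_iff)
    then show "b \<in> ?N2 i"
      using additive_subgroup.zero_closed[OF sub[OF N(2)]] \<open>b \<in> B\<close> unfolding mem_set_add by blast
  qed
  moreover have "?N2 i \<subseteq> C" for i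
    using N(4)[of i] B(3) additive_subgroup.a_closed[OF sub[OF \<open>C \<in> \<S>\<close>]]
    unfolding subset_iff mem_set_add by blast
  moreover have "S \<subseteq> strict_steps ?N1 \<union> strict_steps ?N2"
  proof
    fix i assume "i \<in> S"
    \<comment> \<open>The second equality gives z = y + b with y in N i; then b = z - y lies in N
      (Suc i) \<inter> B, hence in N i by the first equality.\<close>
    have "N (Suc i) \<subseteq> N i" if eq1: "?N1 i = ?N1 (Suc i)" and eq2: "?N2 i = ?N2 (Suc i)"
    proof
      fix z assume z: "z \<in> N (Suc i)"
      then have "z \<oplus> \<zero> \<in> ?N2 (Suc i)"
          using additive_subgroup.zero_closed[OF sub[OF B(1)]] unfolding mem_set_add by blast
      then obtain y b where yb: "y \<in> N i" "b \<in> B" "z = y \<oplus> b"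
        using eq2 z carr[OF N(2)[of "Suc i"]] by (metis mem_set_add r_zero subsetD)
      have c: "y \<in> carrier G" "b \<in> carrier G" "z \<in> carrier G"
        using yb z carr N(2) B(1) by blast+
      have "b = z \<ominus> y" using yb(3) c by (simp add: a_minus_def a_ac r_neg r_neg1 r_neg2)
      then have "b \<in> N (Suc i)"
        using z yb(1) le[of i] sub[OF N(2)[of "Suc i"]]
        by (simp add: a_minus_def additive_subgroup.a_closed additive_subgroup.a_inv_closed subset_iff)
      then have "b \<in> N i" using eq1 yb by auto
      then show "z \<in> N i"
        using yb additive_subgroup.a_closed[OF sub[OF N(2)]] by blast
    qed
    then show "i \<in> strict_steps ?N1 \<union> strict_steps ?N2"
      using \<open>i \<in> S\<close> le[of i] unfolding S strict_steps_def by blast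
  qed
  ultimately have "strict_steps ?N1 \<in> strict_steps ` {N. incseq N \<and> (\<forall>i. N i \<in> \<S> \<and> A \<subseteq> N i \<and> N i \<subseteq> B)}"
      "strict_steps ?N2 \<in> strict_steps ` {N. incseq N \<and> (\<forall>i. N i \<in> \<S> \<and> B \<subseteq> N i \<and> N i \<subseteq> C)}"
      "S \<subseteq> strict_steps ?N1 \<union> strict_steps ?N2"
    by simp_all
  then show "\<exists>S1\<in>strict_steps ` {N. incseq N \<and> (\<forall>i. N i \<in> \<S> \<and> A \<subseteq> N i \<and> N i \<subseteq> B)}.
      \<exists>S2\<in>strict_steps ` {N. incseq N \<and> (\<forall>i. N i \<in> \<S> \<and> B \<subseteq> N i \<and> N i \<subseteq> C)}. S \<subseteq> S1 \<union> S2"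
    by meson
qed

section \<open>Ideals of noetherian and artinian rings\<close>

lemma ideal_subset_carrier: "ideal I R \<Longrightarrow> I \<subseteq> carrier R"
  by (simp add: additive_subgroup.a_subset ideal.axioms(1))

lemma (in ring) short_interval_ideal_trans:
  assumes "ideal B R" "ideal C R" "A \<subseteq> B" "B \<subseteq> C"
    and "short_interval u {I. ideal I R} A B" "short_interval u {I. ideal I R} B C"
  shows "short_interval u {I. ideal I R} A C"
  by (rule short_interval_trans[where B = B])
     (use assms in \<open>auto intro: i_intersect add_ideals ideal.axioms(1)\<close>)

text \<open>The union of an ascending chain of ideals is one of its members, and after that member
  no step is strict. A bound uniform over all chains cannot be expected, whence
  \<open>False\<close>.\<close>

lemma (in noetherian_ring) short_interval_ideals:
  "short_interval False {I. ideal I R} A B"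
proof -
  have "finite (strict_steps N)" if N: "incseq N" "\<And>i. ideal (N i) R" for N :: "nat \<Rightarrow> 'a set"
  proof -
    have "subset.chain {I. ideal I R} (range N)"
    proof -
      have "N i \<subseteq> N j \<or> N j \<subseteq> N i" for i j using N(1) by (metis incseqD nat_le_linear)
      then show ?thesis using N(2) unfolding pred_on.chain_def by blast
    qed
    then have "\<Union>(range N) \<in> range N" by (intro ideal_chain_is_trivial) auto
    then obtain k where k: "\<Union>(range N) = N k" by blast
    have "N i = N (Suc i)" if "k \<le> i" for i
    proof -
      have "N k \<subseteq> N i" "N i \<subseteq> N (Suc i)" using N(1) that by (simp_all add: incseqD)
      then show ?thesis using k by blast
    qed
    then have "strict_steps N \<subseteq> {..<k}" unfolding strict_steps_def by (auto simp: not_less[symmetric])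
    then show ?thesis using finite_subset by blast
  qed
  then show ?thesis unfolding short_interval_def bounded_family_def by auto
qed

section \<open>Artinian rings: finite length from the descending chain condition\<close>

locale artinian_cring = artinian_ring + cring

context artinian_cring
begin

text \<open>Without a minimal member, dependent choice would build a strictly descending sequence.
  Every later use of the descending chain condition has this form.\<close>

lemma minimal_ideal:
  assumes "ideal I0 R" "P I0"
  obtains I where "ideal I R" "P I" "\<And>J. \<lbrakk>ideal J R; P J; J \<subseteq> I\<rbrakk> \<Longrightarrow> J = I"
proof (rule ccontr)
  note minI = that
  assume none: "\<not> thesis"
  have "\<exists>J. (ideal J R \<and> P J) \<and> J \<subset> I" if hyp: "ideal I R \<and> P I" for I
    using none hyp minI[of I] by blast
  then obtain f where f: "\<And>n::nat. ideal (f n) R \<and> P (f n)" "\<And>n. f (Suc n) \<subset> f n"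
    using dependent_nat_choice[of "\<lambda>_ I. ideal I R \<and> P I" "\<lambda>_ I J. J \<subset> I"] assms by metis
  obtain i0 where "\<forall>i\<ge>i0. f i = f i0"
    using descending_chain[of f] f by blast
  then have "f (Suc i0) = f i0" by (metis le_SucI order_refl)
  then show False using f(2)[of i0] by simp
qed

text \<open>Elements outside m are invertible modulo m, so Y/Z is a nonzero vector space over R/m,
  and B is a hyperplane in it. No dimension is known to be finite yet; B comes from Zorn's lemma as
  a maximal ideal between Z and Y that avoids a chosen x.\<close>

lemma simple_layer:
  assumes m: "ideal m R" "\<And>r. r \<in> carrier R \<Longrightarrow> r \<notin> m \<Longrightarrow> \<exists>s\<in>carrier R. \<one> \<ominus> s \<otimes> r \<in> m"
    and Z: "ideal Z R" "ideal Y R" "Z \<subset> Y" "\<And>a y. a \<in> m \<Longrightarrow> y \<in> Y \<Longrightarrow> a \<otimes> y \<in> Z"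
  obtains B where "ideal B R" "Z \<subseteq> B" "B \<subset> Y" "short_interval u {I. ideal I R} B Y"
proof -
  obtain x where x: "x \<in> Y" "x \<notin> Z" using Z(3) by blast
  define F where "F = {B. ideal B R \<and> Z \<subseteq> B \<and> B \<subseteq> Y \<and> x \<notin> B}"
  have "\<exists>B\<in>F. \<forall>V\<in>F. B \<subseteq> V \<longrightarrow> V = B"
  proof (rule subset_Zorn_nonempty)
    show "F \<noteq> {}" using Z x by (auto simp: F_def)
  next
    fix \<C> assume \<C>: "\<C> \<noteq> {}" "subset.chain F \<C>"
    then have "subset.chain {I. ideal I R} \<C>" by (auto simp: pred_on.chain_def F_def)
    then have "ideal (\<Union>\<C>) R" using chain_Union_is_ideal[of \<C>] \<C>(1) by simp
    then show "\<Union>\<C> \<in> F" using \<C> by (fastforce simp: pred_on.chain_def F_def)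
  qed
  then obtain B where B: "ideal B R" "Z \<subseteq> B" "B \<subseteq> Y" "x \<notin> B"
    and max: "\<And>V. ideal V R \<Longrightarrow> B \<subseteq> V \<Longrightarrow> V \<subseteq> Y \<Longrightarrow> x \<notin> V \<Longrightarrow> V = B"
    unfolding F_def by auto
  have YR: "Y \<subseteq> carrier R" by (rule ideal_subset_carrier[OF Z(2)])
  have BR: "B \<subseteq> carrier R" using B(3) YR by blast
  have "C = B \<or> C = Y" if C: "ideal C R" "B \<subseteq> C" "C \<subseteq> Y" for C
  proof (cases "x \<in> C")
    case False
    then show ?thesis using max C by blast
  next
    case True
    \<comment> \<open>For y outside B, maximality of B puts x into B + (y), say x = b + r y. Then r
      is not in m, because m y \<subseteq> Z \<subseteq> B. An inverse s of r modulo m recovers y =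
      s (r y) + (1 - s r) y from members of C.\<close>
    have "y \<in> C" if y: "y \<in> Y" for y
    proof (cases "y \<in> B")
      case False
      interpret C: ideal C R by fact
      interpret B: ideal B R by fact
      have yR: "y \<in> carrier R" and xR: "x \<in> carrier R" using y x YR by auto
      let ?V = "B <+>\<^bsub>R\<^esub> PIdl y"
      have "ideal ?V R" using B(1) cgenideal_ideal[OF yR] by (rule add_ideals)
      moreover have "B \<subseteq> ?V"
      proof
        fix b assume b: "b \<in> B"
        then have "b = b \<oplus> \<zero> \<otimes> y" using BR yR by (simp add: subset_iff)
        then show "b \<in> ?V" using b unfolding mem_set_add cgenideal_def by blast
      qed
      moreover have "y \<in> ?V"
      proof -
        have "y = \<zero> \<oplus> y" using yR by simp
        then show ?thesis using cgenideal_self[OF yR] B.zero_closed unfolding mem_set_add by blast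
      qed
      moreover have "?V \<subseteq> Y"
      proof
        fix z assume "z \<in> ?V"
        then obtain b r where "b \<in> B" "r \<in> carrier R" "z = b \<oplus> r \<otimes> y"
          unfolding mem_set_add cgenideal_def by blast
        then show "z \<in> Y"
          using B(3) additive_subgroup.a_closed[OF ideal.axioms(1)[OF Z(2)]] ideal.I_l_closed[OF Z(2) y] by blast
      qed
      ultimately have "x \<in> ?V" using max[of ?V] False by metis
      then obtain b r where br: "b \<in> B" "r \<in> carrier R" "x = b \<oplus> r \<otimes> y"
        unfolding mem_set_add cgenideal_def by blast
      have bR: "b \<in> carrier R" using br BR by blast
      have "r \<notin> m" using Z(4)[of r y] y B br by auto
      then obtain s where s: "s \<in> carrier R" "\<one> \<ominus> s \<otimes> r \<in> m" using m(2) br by blast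
      have "b \<in> C" using br C by blast
      then have "r \<otimes> y \<in> C"
      proof -
        have "r \<otimes> y = x \<oplus> \<ominus> b" using br yR bR by algebra
        then show ?thesis using True \<open>b \<in> C\<close> by simp
      qed
      then have "s \<otimes> (r \<otimes> y) \<in> C" using s by (simp add: C.I_l_closed)
      moreover have "(\<one> \<ominus> s \<otimes> r) \<otimes> y \<in> C" using Z(4)[OF s(2) y] B C by blast
      moreover have "y = s \<otimes> (r \<otimes> y) \<oplus> (\<one> \<ominus> s \<otimes> r) \<otimes> y" using s br yR by algebra
      ultimately show "y \<in> C" using C.a_closed by metis
    qed (use C in blast)
    then show ?thesis using C by blast
  qed
  then have "short_interval u {I. ideal I R} B Y" by (intro short_interval_two) auto
  then show ?thesis using that B x by blast
qed

text \<open>An artinian vector space has finite dimension: take Y minimal among the ideals between m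
  V and V for which the interval from Y to V is short. Were Y larger than m V,
  \<open>simple_layer\<close> would add one more layer below it.\<close>

lemma short_interval_maximal_mult:
  assumes m: "ideal m R" "\<And>r. r \<in> carrier R \<Longrightarrow> r \<notin> m \<Longrightarrow> \<exists>s\<in>carrier R. \<one> \<ominus> s \<otimes> r \<in> m"
    and V: "ideal V R"
  shows "short_interval True {I. ideal I R} (m \<cdot> V) V"
proof -
  have mX: "ideal (m \<cdot> V) R" "m \<cdot> V \<subseteq> V"
    using ideal_prod_is_ideal ideal_prod_inter m(1) V by auto
  define P where "P Y \<longleftrightarrow> m \<cdot> V \<subseteq> Y \<and> Y \<subseteq> V \<and> short_interval True {I. ideal I R} Y V" for Y
  have "short_interval True {I. ideal I R} V V" by (rule short_interval_two) auto
  then have "P V" using mX by (simp add: P_def)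
  then obtain Y where Y: "ideal Y R" "P Y" and min: "\<And>J. \<lbrakk>ideal J R; P J; J \<subseteq> Y\<rbrakk> \<Longrightarrow> J = Y"
    using minimal_ideal[of V P, OF V] by metis
  note PY = Y(2)[unfolded P_def]
  have "Y = m \<cdot> V"
  proof (rule ccontr)
    assume "Y \<noteq> m \<cdot> V"
    moreover have "a \<otimes> y \<in> m \<cdot> V" if "a \<in> m" "y \<in> Y" for a y
      using that PY by (auto intro: ideal_prod.prod)
    ultimately obtain B where B: "ideal B R" "m \<cdot> V \<subseteq> B" "B \<subset> Y" "short_interval True {I. ideal I R} B Y"
      using simple_layer[OF m mX(1) Y(1), where u = True] PY by blast
    then have "short_interval True {I. ideal I R} B V"
      using short_interval_ideal_trans[OF Y(1) V, of B] PY by blast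
    then have "P B" using B PY by (auto simp: P_def)
    then show False using min[of B] B by blast
  qed
  then show ?thesis using PY by simp
qed

text \<open>
  The ideals I such that I V \<subseteq> V is short for every ideal V contain a minimal one I. It is idempotent and
  absorbed by every maximal ideal m. If I \<noteq> 0, take J minimal with J I \<noteq> 0; then J = (x), the annihilator
  m of x I is maximal, so I = m I \<subseteq> m and x I = x I I = 0, a contradiction.
\<close>

lemma short_interval_carrier:
  "short_interval True {I. ideal I R} {\<zero>} (carrier R)"
proof -
  define Q where "Q I \<longleftrightarrow> (\<forall>V. ideal V R \<longrightarrow> short_interval True {I. ideal I R} (I \<cdot> V) V)" for I
  have "Q (carrier R)"
    unfolding Q_def using ideal_prod_one ideal_prod_commute[OF oneideal]
    by (auto intro: short_interval_two)
  then obtain I where I: "ideal I R" "Q I" and min: "\<And>J. \<lbrakk>ideal J R; Q J; J \<subseteq> I\<rbrakk> \<Longrightarrow> J = I"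
    using minimal_ideal oneideal by blast
  \<comment> \<open>Both layers of J I V \<subseteq> I V \<subseteq> V are short, so J I qualifies
    as well and equals I by minimality. J = I gives idempotence, J = m the absorption by m.\<close>
  have absorb: "J \<cdot> I = I" if J: "ideal J R" "Q J" for J
  proof (rule min)
    show "ideal (J \<cdot> I) R" using ideal_prod_is_ideal J I by blast
    show "J \<cdot> I \<subseteq> I" using ideal_prod_inter J I by blast
    have "short_interval True {I. ideal I R} (J \<cdot> I \<cdot> V) V" if "ideal V R" for V
    proof -
      have IX: "ideal (I \<cdot> V) R" "I \<cdot> V \<subseteq> V" using ideal_prod_is_ideal ideal_prod_inter that I by auto
      have JIX: "J \<cdot> (I \<cdot> V) \<subseteq> I \<cdot> V" using ideal_prod_inter[OF J(1) IX(1)] by blast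
      show ?thesis
        using short_interval_ideal_trans[OF IX(1) that JIX IX(2)] ideal_prod_assoc[OF J(1) I(1) that] J(2) I(2) IX that
        by (simp add: Q_def)
    qed
    then show "Q (J \<cdot> I)" by (simp add: Q_def)
  qed
  have IR: "I \<subseteq> carrier R" by (rule ideal_subset_carrier[OF I(1)])
  have "I = {\<zero>}"
  proof (rule ccontr)
    assume "I \<noteq> {\<zero>}"
    then have "\<exists>j\<in>I. \<exists>i\<in>I. j \<otimes> i \<noteq> \<zero>"
    proof -
      have "\<exists>z\<in>I. z \<noteq> \<zero>" using \<open>I \<noteq> {\<zero>}\<close> additive_subgroup.zero_closed[OF ideal.axioms(1)[OF I(1)]] by blast
      moreover have "z = \<zero>" if "z \<in> I \<cdot> I" "\<forall>j\<in>I. \<forall>i\<in>I. j \<otimes> i = \<zero>" for z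
        using that by induction auto
      ultimately show ?thesis using absorb[OF I] by metis
    qed
    then obtain J where J: "ideal J R" "\<exists>j\<in>J. \<exists>i\<in>I. j \<otimes> i \<noteq> \<zero>"
      and Jmin: "\<And>K. \<lbrakk>ideal K R; \<exists>j\<in>K. \<exists>i\<in>I. j \<otimes> i \<noteq> \<zero>; K \<subseteq> J\<rbrakk> \<Longrightarrow> K = J"
      using minimal_ideal[of I "\<lambda>J. \<exists>j\<in>J. \<exists>i\<in>I. j \<otimes> i \<noteq> \<zero>"] I(1) by blast
    obtain x where x: "x \<in> J" "\<exists>i\<in>I. x \<otimes> i \<noteq> \<zero>" using J by blast
    have xR: "x \<in> carrier R" using x ideal_subset_carrier[OF J(1)] by blast
    have PJ: "PIdl y = J" if "y \<in> J" "\<exists>i\<in>I. y \<otimes> i \<noteq> \<zero>" for y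
    proof (rule Jmin)
      have yR: "y \<in> carrier R" using that ideal_subset_carrier[OF J(1)] by blast
      show "ideal (PIdl y) R" by (rule cgenideal_ideal[OF yR])
      show "\<exists>j\<in>PIdl y. \<exists>i\<in>I. j \<otimes> i \<noteq> \<zero>" using cgenideal_self[OF yR] that by blast
      show "PIdl y \<subseteq> J" by (rule cgenideal_minimal[OF J(1) that(1)])
    qed
    define m where "m = {r \<in> carrier R. \<forall>i\<in>I. r \<otimes> x \<otimes> i = \<zero>}"
    have m: "ideal m R"
    proof (rule idealI)
      have iR: "i \<in> carrier R" if "i \<in> I" for i using that IR by blast
      show "subgroup m (add_monoid R)"
      proof (rule add.subgroupI)
        show "m \<subseteq> carrier R" by (auto simp: m_def)
        have "\<zero> \<in> m" using xR iR by (simp add: m_def)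
        then show "m \<noteq> {}" by blast
        show "\<ominus> a \<in> m" if "a \<in> m" for a
          using that xR iR by (simp add: m_def l_minus)
        show "a \<oplus> b \<in> m" if "a \<in> m" "b \<in> m" for a b
          using that xR iR by (simp add: m_def l_distr)
      qed
      show l: "y \<otimes> a \<in> m" if "a \<in> m" "y \<in> carrier R" for a y
      proof -
        have "y \<otimes> a \<otimes> x \<otimes> i = y \<otimes> (a \<otimes> x \<otimes> i)" if "i \<in> I" for i
          using \<open>a \<in> m\<close> \<open>y \<in> carrier R\<close> xR iR[OF that] by (simp add: m_def m_assoc)
        then show ?thesis using that by (simp add: m_def)
      qed
      show "a \<otimes> y \<in> m" if "a \<in> m" "y \<in> carrier R" for a y
        using l[OF that] that m_comm[of a y] by (simp add: m_def)
    qed (rule ring_axioms)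
    \<comment> \<open>As r x I \<noteq> 0, minimality of J makes r x a generator of J. So x = s r x
      for some s, and 1 - s r annihilates x.\<close>
    have maxm: "\<exists>s\<in>carrier R. \<one> \<ominus> s \<otimes> r \<in> m" if r: "r \<in> carrier R" "r \<notin> m" for r
    proof -
      have "r \<otimes> x \<in> J" using x r J by (simp add: ideal.I_l_closed)
      then have "PIdl (r \<otimes> x) = J" using PJ r by (simp add: m_def)
      then obtain s where s: "s \<in> carrier R" "x = s \<otimes> (r \<otimes> x)" using x unfolding cgenideal_def by auto
      have "(\<one> \<ominus> s \<otimes> r) \<otimes> x = x \<ominus> s \<otimes> (r \<otimes> x)" using s(1) r xR by algebra
      also have "\<dots> = \<zero>" using s xR by (metis minus_eq r_neg)
      finally have "(\<one> \<ominus> s \<otimes> r) \<otimes> x = \<zero>" .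
      then have "\<one> \<ominus> s \<otimes> r \<in> m" using s(1) r xR IR by (auto simp: m_def)
      then show ?thesis using s by blast
    qed
    have "Q m" using short_interval_maximal_mult[OF m maxm] by (simp add: Q_def)
    then have "m \<cdot> I = I" using absorb m by blast
    then have "I \<subseteq> m" using ideal_prod_inter[OF m I(1)] by blast
    have "x \<otimes> z = \<zero>" if "z \<in> I \<cdot> I" for z
      using that
    proof induction
      case (prod i j)
      then have "i \<otimes> x \<otimes> j = \<zero>" using \<open>I \<subseteq> m\<close> by (auto simp: m_def)
      moreover have "i \<in> carrier R" "j \<in> carrier R" using prod IR by auto
      ultimately show ?case using xR by (metis m_assoc m_comm)
    next
      case (sum s t)
      then have "s \<in> carrier R" "t \<in> carrier R" using ideal_prod_in_carrier[OF I(1) I(1)] by auto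
      then show ?case using sum xR by (simp add: r_distr)
    qed
    then show False using x(2) absorb[OF I] by auto
  qed
  \<comment> \<open>With I = 0, the layer from I V to V for V = R is the claim.\<close>
  then have "Q {\<zero>}" using I by simp
  then show ?thesis using oneideal ideal_prod_zero[OF oneideal] ideal_prod_commute[OF oneideal zeroideal]
    unfolding Q_def by metis
qed

end

section \<open>Finitely generated modules\<close>

lemma submodule_additive_subgroup: "submodule H R M \<Longrightarrow> additive_subgroup H M"
  by (simp add: additive_subgroup_def submodule_def)

lemma (in module) submodule_Int:
  assumes "submodule H R M" "submodule K R M"
  shows "submodule (H \<inter> K) R M"
proof -
  interpret H: submodule H R M by fact
  interpret K: submodule K R M by fact
  have "subgroup (H \<inter> K) (add_monoid M)"
    by (rule M.add.subgroups_Inter_pair[OF H.subgroup_axioms K.subgroup_axioms])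
  then show ?thesis by (auto simp: submodule_def submodule_axioms_def)
qed

lemma (in module) submodule_set_add:
  assumes H: "submodule H R M" and K: "submodule K R M"
  shows "submodule (H <+>\<^bsub>M\<^esub> K) R M"
proof -
  have "additive_subgroup (H <+>\<^bsub>M\<^esub> K) M"
    using H K by (intro add_additive_subgroups submodule_additive_subgroup)
  moreover have "a \<odot>\<^bsub>M\<^esub> z \<in> H <+>\<^bsub>M\<^esub> K" if az: "a \<in> carrier R" "z \<in> H <+>\<^bsub>M\<^esub> K" for a z
  proof -
    obtain h k where hk: "h \<in> H" "k \<in> K" "z = h \<oplus>\<^bsub>M\<^esub> k" using az(2) unfolding M.mem_set_add by blast
    then have "a \<odot>\<^bsub>M\<^esub> z = a \<odot>\<^bsub>M\<^esub> h \<oplus>\<^bsub>M\<^esub> a \<odot>\<^bsub>M\<^esub> k"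
      using az(1) submoduleE(1)[OF H] submoduleE(1)[OF K] by (simp add: smult_r_distr subset_iff)
    then show ?thesis
      using hk az(1) submoduleE(4)[OF H] submoduleE(4)[OF K] unfolding M.mem_set_add by blast
  qed
  ultimately show ?thesis
    by (simp add: submodule_def submodule_axioms_def additive_subgroup_def)
qed

lemma (in module) submodule_cyclic:
  assumes x: "x \<in> carrier M"
  shows "submodule {r \<odot>\<^bsub>M\<^esub> x | r. r \<in> carrier R} R M" (is "submodule ?S R M")
proof (rule submoduleI)
  show "?S \<subseteq> carrier M" using x by auto
  show "\<zero>\<^bsub>M\<^esub> \<in> ?S" using x smult_l_null[of x] by force
  show "\<ominus>\<^bsub>M\<^esub> a \<in> ?S" if a: "a \<in> ?S" for a
  proof -
    obtain r where "r \<in> carrier R" "a = r \<odot>\<^bsub>M\<^esub> x" using a by blast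
    then have "\<ominus> r \<in> carrier R" "\<ominus>\<^bsub>M\<^esub> a = (\<ominus> r) \<odot>\<^bsub>M\<^esub> x" using x smult_l_minus by auto
    then show ?thesis by blast
  qed
  show "a \<oplus>\<^bsub>M\<^esub> b \<in> ?S" if ab: "a \<in> ?S" "b \<in> ?S" for a b
  proof -
    obtain r s where "r \<in> carrier R" "a = r \<odot>\<^bsub>M\<^esub> x" "s \<in> carrier R" "b = s \<odot>\<^bsub>M\<^esub> x"
      using ab by blast
    then have "r \<oplus> s \<in> carrier R" "a \<oplus>\<^bsub>M\<^esub> b = (r \<oplus> s) \<odot>\<^bsub>M\<^esub> x" using x smult_l_distr by auto
    then show ?thesis by blast
  qed
  show "a \<odot>\<^bsub>M\<^esub> b \<in> ?S" if ab: "a \<in> carrier R" "b \<in> ?S" for a b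
  proof -
    obtain s where "s \<in> carrier R" "b = s \<odot>\<^bsub>M\<^esub> x" using ab by blast
    then have "a \<otimes> s \<in> carrier R" "a \<odot>\<^bsub>M\<^esub> b = (a \<otimes> s) \<odot>\<^bsub>M\<^esub> x"
      using x ab smult_assoc1 by auto
    then show ?thesis by blast
  qed
qed

lemma (in module) colon_ideal:
  assumes C: "submodule C R M" and x: "x \<in> carrier M"
  shows "ideal {r \<in> carrier R. r \<odot>\<^bsub>M\<^esub> x \<in> C} R" (is "ideal ?I R")
proof (rule idealI)
  have zero: "\<zero>\<^bsub>M\<^esub> \<in> C"
    using additive_subgroup.zero_closed[OF submodule_additive_subgroup[OF C]] .
  show "subgroup ?I (add_monoid R)"
  proof (rule R.add.subgroupI)
    have "\<zero> \<in> ?I" using x zero by simp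
    then show "?I \<noteq> {}" by blast
    show "\<ominus> a \<in> ?I" if "a \<in> ?I" for a
      using that x submoduleE(3)[OF C] by (simp add: smult_l_minus)
    show "a \<oplus> b \<in> ?I" if "a \<in> ?I" "b \<in> ?I" for a b
      using that x submoduleE(5)[OF C] by (simp add: smult_l_distr)
  qed auto
  show l: "y \<otimes> a \<in> ?I" if "a \<in> ?I" "y \<in> carrier R" for a y
    using that x submoduleE(4)[OF C] by (simp add: smult_assoc1)
  show "a \<otimes> y \<in> ?I" if "a \<in> ?I" "y \<in> carrier R" for a y
    using l[OF that] that by (simp add: m_comm)
qed (rule R.ring_axioms)

text \<open>(A + R x)/A is cyclic, so its submodules are governed by ideals of R: C is sent to (C :
  x) and recovered as A + (C : x) x.\<close>

lemma (in module) short_interval_adjoin: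
  assumes short: "short_interval u {I. ideal I R} {\<zero>} (carrier R)"
    and A: "submodule A R M" and x: "x \<in> carrier M"
  shows "short_interval u {T. submodule T R M} A (A <+>\<^bsub>M\<^esub> {r \<odot>\<^bsub>M\<^esub> x | r. r \<in> carrier R})"
    (is "short_interval u _ A ?B")
proof (rule short_interval_transfer[OF short, where \<Phi> = "\<lambda>C. {r \<in> carrier R. r \<odot>\<^bsub>M\<^esub> x \<in> C}"])
  show "mono_on {C \<in> {T. submodule T R M}. A \<subseteq> C \<and> C \<subseteq> ?B} (\<lambda>C. {r \<in> carrier R. r \<odot>\<^bsub>M\<^esub> x \<in> C})"
    by (auto intro: mono_onI)
next
  fix C assume "C \<in> {T. submodule T R M}"
  then have C: "submodule C R M" by simp
  show "{r \<in> carrier R. r \<odot>\<^bsub>M\<^esub> x \<in> C} \<in> {I. ideal I R} \<and> {\<zero>} \<subseteq> {r \<in> carrier R. r \<odot>\<^bsub>M\<^esub> x \<in> C} \<and>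
      {r \<in> carrier R. r \<odot>\<^bsub>M\<^esub> x \<in> C} \<subseteq> carrier R"
    using colon_ideal[OF C x] additive_subgroup.zero_closed[OF ideal.axioms(1)[OF colon_ideal[OF C x]]]
    by auto
next
  fix C D
  assume CD: "C \<in> {T. submodule T R M}" "D \<in> {T. submodule T R M}" and le: "A \<subseteq> C" "C \<subseteq> D" "D \<subseteq> ?B"
    and eq: "{r \<in> carrier R. r \<odot>\<^bsub>M\<^esub> x \<in> C} = {r \<in> carrier R. r \<odot>\<^bsub>M\<^esub> x \<in> D}"
  from CD have C: "submodule C R M" and D: "submodule D R M" by auto
  show "D \<subseteq> C"
  proof
    fix z assume z: "z \<in> D"
    then have "z \<in> ?B" using le(3) by blast
    then obtain a r where ar: "a \<in> A" "r \<in> carrier R" "z = a \<oplus>\<^bsub>M\<^esub> r \<odot>\<^bsub>M\<^esub> x"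
      unfolding M.mem_set_add by blast
    have "a \<in> carrier M" using ar submoduleE(1)[OF A] by blast
    then have rx: "r \<odot>\<^bsub>M\<^esub> x = \<ominus>\<^bsub>M\<^esub> a \<oplus>\<^bsub>M\<^esub> z" using ar x by (simp add: M.r_neg1)
    have "a \<in> D" using ar le by blast
    then have "r \<odot>\<^bsub>M\<^esub> x \<in> D"
      unfolding rx using z submoduleE(3,5)[OF D] by blast
    then have "r \<odot>\<^bsub>M\<^esub> x \<in> C" using eq ar by blast
    then show "z \<in> C" using ar le submoduleE(5)[OF C] by blast
  qed
qed

text \<open>The induction over G carries along some submodule B that contains the generators so far
  and has a short interval below it; only at the end is B identified with the whole module.\<close>

lemma (in module) short_interval_finitely_generated:
  assumes short: "short_interval u {I. ideal I R} {\<zero>} (carrier R)"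
    and gens: "finite G" "G \<subseteq> carrier M" "\<And>T. submodule T R M \<Longrightarrow> G \<subseteq> T \<Longrightarrow> carrier M \<subseteq> T"
  shows "short_interval u {T. submodule T R M} {\<zero>\<^bsub>M\<^esub>} (carrier M)"
proof -
  have "\<exists>B. submodule B R M \<and> G \<subseteq> B \<and> short_interval u {T. submodule T R M} {\<zero>\<^bsub>M\<^esub>} B"
    using gens(1,2)
  proof induction
    case empty
    have "submodule {\<zero>\<^bsub>M\<^esub>} R M" by (rule submoduleI) auto
    moreover have "short_interval u {T. submodule T R M} {\<zero>\<^bsub>M\<^esub>} {\<zero>\<^bsub>M\<^esub>}"
      by (rule short_interval_two) auto
    ultimately show ?case by blast
  next
    case (insert x F)
    then obtain B where B: "submodule B R M" "F \<subseteq> B" "short_interval u {T. submodule T R M} {\<zero>\<^bsub>M\<^esub>} B"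
      by blast
    have x: "x \<in> carrier M" using insert by blast
    let ?X = "{r \<odot>\<^bsub>M\<^esub> x | r. r \<in> carrier R}"
    let ?B = "B <+>\<^bsub>M\<^esub> ?X"
    have B': "submodule ?B R M" by (rule submodule_set_add[OF B(1) submodule_cyclic[OF x]])
    have zero: "\<zero>\<^bsub>M\<^esub> \<in> T" if "submodule T R M" for T
      using additive_subgroup.zero_closed[OF submodule_additive_subgroup[OF that]] .
    have "B \<subseteq> ?B"
    proof
      fix b assume b: "b \<in> B"
      then have "b = b \<oplus>\<^bsub>M\<^esub> \<zero>\<^bsub>M\<^esub>" using submoduleE(1)[OF B(1)] by (simp add: subset_iff)
      then show "b \<in> ?B" using b zero[OF submodule_cyclic[OF x]] unfolding M.mem_set_add by blast
    qed
    have "x \<in> ?B"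
    proof -
      have "x = \<zero>\<^bsub>M\<^esub> \<oplus>\<^bsub>M\<^esub> \<one> \<odot>\<^bsub>M\<^esub> x" using x by simp
      then show ?thesis using zero[OF B(1)] unfolding M.mem_set_add by blast
    qed
    have "short_interval u {T. submodule T R M} {\<zero>\<^bsub>M\<^esub>} ?B"
    proof (rule short_interval_trans[where B = B])
      show "H \<inter> K \<in> {T. submodule T R M}" "H <+>\<^bsub>M\<^esub> K \<in> {T. submodule T R M}"
        if "H \<in> {T. submodule T R M}" "K \<in> {T. submodule T R M}" for H K
        using that submodule_Int submodule_set_add by auto
      show "short_interval u {T. submodule T R M} B ?B"
        by (rule short_interval_adjoin[OF short B(1) x])
    qed (use B B' \<open>B \<subseteq> ?B\<close> zero in \<open>auto intro: submodule_additive_subgroup\<close>)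
    then show ?case using B' \<open>B \<subseteq> ?B\<close> \<open>x \<in> ?B\<close> B(2) by blast
  qed
  then obtain B where B: "submodule B R M" "G \<subseteq> B" "short_interval u {T. submodule T R M} {\<zero>\<^bsub>M\<^esub>} B"
    by blast
  then have "B = carrier M" using gens(3) submoduleE(1) by blast
  then show ?thesis using B(3) by simp
qed

section \<open>Maps between the objects\<close>

lemma FA_compose: "f \<in> FA l m \<Longrightarrow> g \<in> FA m n \<Longrightarrow> compose {1..l} g f \<in> FA l n"
  by (auto simp: FA_def compose_def PiE_iff)

lemma OA_compose: "f \<in> OA l m \<Longrightarrow> g \<in> OA m n \<Longrightarrow> compose {1..l} g f \<in> OA l n"
  using FA_compose[of f l m g n]
  by (auto simp: OA_def FA_def compose_def PiE_iff intro!: mono_onI elim!: mono_onD)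

lemma finite_FA: "finite (FA m n)"
  unfolding FA_def by (intro finite_PiE) auto

lemma id_in_OA: "restrict id {1..n} \<in> OA n n"
  by (auto simp: OA_def FA_def mono_on_def)

lemma compose_id_right: "f \<in> FA m n \<Longrightarrow> compose {1..m} f (restrict id {1..m}) = f"
  by (auto simp: FA_def compose_def fun_eq_iff PiE_iff extensional_def)

lemma rot_power_range: "i \<in> {1..n} \<Longrightarrow> (rot n ^^ j) i \<in> {1..n}"
  by (induction j) (auto simp: rot_def)

lemma OA_subset_CA: "OA m n \<subseteq> CA m n"
proof
  fix f assume f: "f \<in> OA m n"
  then have "f = compose {1..m} (rot n ^^ 0) (compose {1..m} f (rot m ^^ 0))"
    by (auto simp: OA_def FA_def compose_def fun_eq_iff PiE_iff extensional_def)
  then show "f \<in> CA m n" using f unfolding CA_def by blast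
qed

lemma CA_subset_FA: "CA m n \<subseteq> FA m n"
proof
  fix f assume "f \<in> CA m n"
  then obtain i j g where g: "g \<in> OA m n"
    and f: "f = compose {1..m} (rot n ^^ j) (compose {1..m} g (rot m ^^ i))"
    unfolding CA_def by blast
  have "g k \<in> {1..n}" if "k \<in> {1..m}" for k using g that by (auto simp: OA_def FA_def)
  then show "f \<in> FA m n"
    unfolding f FA_def using rot_power_range by (auto simp: compose_def simp del: atLeastAtMost_iff)
qed

lemma OA_subset_category: "C \<in> {FA, OA, CA, BA, SA} \<Longrightarrow> OA m n \<subseteq> C m n"
  using OA_subset_CA[of m n] by (auto simp: OA_def BA_def SA_def)

lemma category_subset_FA: "C \<in> {FA, OA, CA, BA, SA} \<Longrightarrow> C m n \<subseteq> FA m n"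
  using CA_subset_FA[of m n] by (auto simp: OA_def BA_def SA_def)

section \<open>Simplicial operators and the idempotents e_j\<close>

definition coface :: "nat \<Rightarrow> nat \<Rightarrow> nat \<Rightarrow> nat" where
  "coface n k = (\<lambda>i\<in>{1..n - 1}. if i \<le> Suc k then i else Suc i)"

definition codegeneracy :: "nat \<Rightarrow> nat \<Rightarrow> nat \<Rightarrow> nat" where
  "codegeneracy n k = (\<lambda>i\<in>{1..n}. if i \<le> Suc k then i else i - 1)"

text \<open>The map e_j of the overview for j = k + 1; counting k from 0 suits the recursion of
  \<open>conormalize\<close>. It is an idempotent whose image omits exactly k + 2.\<close>

definition collapse :: "nat \<Rightarrow> nat \<Rightarrow> nat \<Rightarrow> nat" where
  "collapse n k = (\<lambda>i\<in>{1..n}. if i = k + 2 then Suc k else i)"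

lemma coface_OA: "k + 2 \<le> n \<Longrightarrow> coface n k \<in> OA (n - 1) n"
  by (auto simp: coface_def OA_def FA_def mono_on_def)

lemma codegeneracy_OA: "k + 2 \<le> n \<Longrightarrow> codegeneracy n k \<in> OA n (n - 1)"
  by (auto simp: codegeneracy_def OA_def FA_def mono_on_def)

lemma collapse_OA: "k + 2 \<le> n \<Longrightarrow> collapse n k \<in> OA n n"
  by (auto simp: collapse_def OA_def FA_def mono_on_def)

text \<open>This lets degree n - 1 control degree n: every vector in the image of a collapse comes
  from M(n - 1).\<close>

lemma collapse_factor:
  "k + 2 \<le> n \<Longrightarrow> collapse n k = compose {1..n} (coface n k) (codegeneracy n k)"
  by (auto simp: collapse_def coface_def codegeneracy_def compose_def fun_eq_iff)

text \<open>After \<open>collapse n j\<close> the value j + 2 is gone, and the only value that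
  \<open>collapse n k\<close> can produce anew is k + 1 < j + 2.\<close>

lemma collapse_absorb:
  assumes "k < j" "j + 2 \<le> n"
  shows "compose {1..n} (collapse n j) (compose {1..n} (collapse n k) (collapse n j)) =
    compose {1..n} (collapse n k) (collapse n j)"
proof
  fix i
  show "compose {1..n} (collapse n j) (compose {1..n} (collapse n k) (collapse n j)) i =
      compose {1..n} (collapse n k) (collapse n j) i"
    by (cases "i \<in> {1..n}"; cases "i = j + 2"; cases "i = k + 2"; cases "j = Suc k")
       (use assms in \<open>simp_all add: collapse_def compose_def\<close>)
qed

lemma collapse_fixes:
  assumes "f \<in> FA d n" "j + 2 \<notin> f ` {1..d}"
  shows "compose {1..d} (collapse n j) f = f"
proof
  fix i
  show "compose {1..d} (collapse n j) f i = f i"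
  proof (cases "i \<in> {1..d}")
    case True
    then have "f i \<in> {1..n}" "f i \<noteq> j + 2" using assms unfolding FA_def by (blast, metis imageI)
    then show ?thesis using True by (simp add: collapse_def compose_def)
  qed (use assms in \<open>auto simp: FA_def compose_def PiE_iff extensional_def\<close>)
qed

text \<open>Pigeonhole among the n - 1 points 2, ..., n. The point 1 is left out because every
  collapse has it in its image; hence d + 2 and not d + 1.\<close>

lemma FA_misses:
  assumes f: "f \<in> FA d n" and "d + 2 \<le> n"
  obtains j where "j + 2 \<le> n" "j + 2 \<notin> f ` {1..d}"
proof -
  have "card (f ` {1..d}) \<le> d" using card_image_le[of "{1..d}" f] by simp
  also have "\<dots> < card {2..n}" using assms by simp
  finally have "\<not> {2..n} \<subseteq> f ` {1..d}" by (meson card_mono finite_atLeastAtMost finite_imageI not_le)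
  then obtain i where i: "2 \<le> i" "i \<le> n" "i \<notin> f ` {1..d}" by (meson atLeastAtMost_iff subsetI)
  then obtain j where "i = j + 2" using le_Suc_ex[of 2 i] by auto
  then show ?thesis using that[of j] i by simp
qed

section \<open>Submodules are determined in bounded degree\<close>

lemma linear_map_closed: "linear_map R A B f \<Longrightarrow> x \<in> carrier A \<Longrightarrow> f x \<in> carrier B"
  by (auto simp: linear_map_def)

lemma linear_map_add:
  "linear_map R A B f \<Longrightarrow> x \<in> carrier A \<Longrightarrow> y \<in> carrier A \<Longrightarrow> f (x \<oplus>\<^bsub>A\<^esub> y) = f x \<oplus>\<^bsub>B\<^esub> f y"
  by (auto simp: linear_map_def)

lemma linear_map_smult:
  "linear_map R A B f \<Longrightarrow> a \<in> carrier R \<Longrightarrow> x \<in> carrier A \<Longrightarrow> f (a \<odot>\<^bsub>A\<^esub> x) = a \<odot>\<^bsub>B\<^esub> f x"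
  by (auto simp: linear_map_def)

lemma linear_map_zero:
  assumes "module R A" "module R B" "linear_map R A B f"
  shows "f \<zero>\<^bsub>A\<^esub> = \<zero>\<^bsub>B\<^esub>"
proof -
  interpret A: module R A by fact
  interpret B: module R B by fact
  have "f (\<zero>\<^bsub>R\<^esub> \<odot>\<^bsub>A\<^esub> \<zero>\<^bsub>A\<^esub>) = \<zero>\<^bsub>R\<^esub> \<odot>\<^bsub>B\<^esub> f \<zero>\<^bsub>A\<^esub>"
    using assms(3) by (intro linear_map_smult) auto
  then show ?thesis using linear_map_closed[OF assms(3)] by simp
qed

lemma linear_map_minus:
  assumes "module R A" "module R B" "linear_map R A B f" and x: "x \<in> carrier A" "y \<in> carrier A"
  shows "f (x \<ominus>\<^bsub>A\<^esub> y) = f x \<ominus>\<^bsub>B\<^esub> f y"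
proof -
  interpret A: module R A by fact
  interpret B: module R B by fact
  have "\<ominus>\<^bsub>A\<^esub> y = (\<ominus>\<^bsub>R\<^esub> \<one>\<^bsub>R\<^esub>) \<odot>\<^bsub>A\<^esub> y" using x by (simp add: A.smult_l_minus)
  then have "f (\<ominus>\<^bsub>A\<^esub> y) = (\<ominus>\<^bsub>R\<^esub> \<one>\<^bsub>R\<^esub>) \<odot>\<^bsub>B\<^esub> f y"
    using x linear_map_smult[OF assms(3)] by simp
  also have "\<dots> = \<ominus>\<^bsub>B\<^esub> f y" using linear_map_closed[OF assms(3)] x by (simp add: B.smult_l_minus)
  finally show ?thesis using x linear_map_add[OF assms(3)] by (simp add: a_minus_def)
qed

lemma linear_map_comp:
  "linear_map R A B f \<Longrightarrow> linear_map R B D g \<Longrightarrow> linear_map R A D (\<lambda>x. g (f x))"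
  by (simp add: linear_map_def Pi_iff)

lemma linear_map_diff:
  assumes "module R A" "module R B" "linear_map R A B f" "linear_map R A B g"
  shows "linear_map R A B (\<lambda>x. f x \<ominus>\<^bsub>B\<^esub> g x)"
proof -
  interpret A: module R A by fact
  interpret B: module R B by fact
  note fg = linear_map_closed[OF assms(3)] linear_map_closed[OF assms(4)]
  show ?thesis
    unfolding linear_map_def
  proof (intro conjI ballI)
    show "(\<lambda>x. f x \<ominus>\<^bsub>B\<^esub> g x) \<in> carrier A \<rightarrow> carrier B" using fg by auto
    show "f (x \<oplus>\<^bsub>A\<^esub> y) \<ominus>\<^bsub>B\<^esub> g (x \<oplus>\<^bsub>A\<^esub> y) = f x \<ominus>\<^bsub>B\<^esub> g x \<oplus>\<^bsub>B\<^esub> (f y \<ominus>\<^bsub>B\<^esub> g y)"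
      if "x \<in> carrier A" "y \<in> carrier A" for x y
      using that fg linear_map_add[OF assms(3)] linear_map_add[OF assms(4)]
      by (simp add: a_minus_def B.minus_add B.add.m_ac)
    show "f (a \<odot>\<^bsub>A\<^esub> x) \<ominus>\<^bsub>B\<^esub> g (a \<odot>\<^bsub>A\<^esub> x) = a \<odot>\<^bsub>B\<^esub> (f x \<ominus>\<^bsub>B\<^esub> g x)"
      if "a \<in> carrier R" "x \<in> carrier A" for a x
      using that fg linear_map_smult[OF assms(3)] linear_map_smult[OF assms(4)]
      by (simp add: a_minus_def B.smult_r_distr B.smult_r_minus)
  qed
qed

lemma linear_map_kernel:
  assumes "module R A" "module R B" "linear_map R A B f"
  shows "submodule {x \<in> carrier A. f x = \<zero>\<^bsub>B\<^esub>} R A"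
proof -
  interpret A: module R A by fact
  interpret B: module R B by fact
  have "f (\<ominus>\<^bsub>A\<^esub> x) = \<ominus>\<^bsub>B\<^esub> f x" if "x \<in> carrier A" for x
    using linear_map_minus[OF assms, of "\<zero>\<^bsub>A\<^esub>" x] linear_map_zero[OF assms] that
      linear_map_closed[OF assms(3) that] by (simp add: a_minus_def)
  then show ?thesis
    using linear_map_zero[OF assms] linear_map_add[OF assms(3)] linear_map_smult[OF assms(3)]
    by (intro A.submoduleI) auto
qed

text \<open>The five categories enter only through this sandwich: the lower inclusion supplies
  cofaces, codegeneracies, collapses and identities, the upper one finite morphism sets and the
  pigeonhole argument.\<close>

locale module_over_OA = cat_module R C M
  for R :: "('a, 'r) ring_scheme" and C :: category and M :: "('a, 'b) cat_functor" +
  assumes OA_subset: "OA m n \<subseteq> C m n" and subset_FA: "C m n \<subseteq> FA m n"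
begin

lemma act_closed:
  "\<lbrakk>m > 0; n > 0; f \<in> C m n; x \<in> carrier (obj M m)\<rbrakk> \<Longrightarrow> act M m n f x \<in> carrier (obj M n)"
  by (rule linear_map_closed[OF act_linear])

text \<open>
  The product of the factors 1 - (collapse n j) for j < k, applied in increasing order of j; as in the
  Dold-Kan correspondence, its image for k = n - 1 is the part not coming from smaller objects.
\<close>

primrec conormalize :: "nat \<Rightarrow> nat \<Rightarrow> 'b \<Rightarrow> 'b" where
  "conormalize n 0 x = x"
| "conormalize n (Suc k) x =
    conormalize n k x \<ominus>\<^bsub>obj M n\<^esub> act M n n (collapse n k) (conormalize n k x)"

lemma collapse_in: "k + 2 \<le> n \<Longrightarrow> collapse n k \<in> C n n"
  using collapse_OA OA_subset by blast

lemma conormalize_linear: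
  assumes "k + 1 \<le> n"
  shows "linear_map R (obj M n) (obj M n) (conormalize n k)"
  using assms
proof (induction k)
  case 0
  then show ?case by (auto simp: linear_map_def)
next
  case (Suc k)
  note f = Suc.IH[OF Suc_leD[OF Suc.prems[unfolded add_Suc]]]
  have "linear_map R (obj M n) (obj M n)
      (\<lambda>x. conormalize n k x \<ominus>\<^bsub>obj M n\<^esub> act M n n (collapse n k) (conormalize n k x))"
    using Suc.prems collapse_in[of k n]
    by (intro linear_map_diff f linear_map_comp[OF f] act_linear obj_module) auto
  then show ?case by (simp add: linear_map_def)
qed

lemma conormalize_closed:
  "\<lbrakk>k + 1 \<le> n; x \<in> carrier (obj M n)\<rbrakk> \<Longrightarrow> conormalize n k x \<in> carrier (obj M n)"
  by (rule linear_map_closed[OF conormalize_linear])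

text \<open>Write c_k for \<open>collapse n k\<close>. If c_j fixes y and k < j, it also fixes c_k
  y, since c_k y = c_k c_j y = c_j c_k c_j y = c_j c_k y.\<close>

lemma conormalize_fixed:
  assumes "k \<le> j" and j: "j + 2 \<le> n" and x: "x \<in> carrier (obj M n)"
    and fixed: "act M n n (collapse n j) x = x"
  shows "act M n n (collapse n j) (conormalize n k x) = conormalize n k x"
  using assms(1)
proof (induction k)
  case 0
  then show ?case using fixed by simp
next
  case (Suc k)
  let ?y = "conormalize n k x" and ?a = "act M n n"
  have n: "0 < n" and C: "collapse n k \<in> C n n" "collapse n j \<in> C n n"
    using j Suc.prems collapse_in by auto
  have y: "?y \<in> carrier (obj M n)" "?a (collapse n j) ?y = ?y"
    using Suc j x conormalize_closed by auto
  have ey: "?a (collapse n k) ?y \<in> carrier (obj M n)" using act_closed n C y by blast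
  have OA: "compose {1..n} (collapse n k) (collapse n j) \<in> C n n"
  proof -
    have "collapse n k \<in> OA n n" "collapse n j \<in> OA n n" using j Suc.prems collapse_OA by auto
    then have "compose {1..n} (collapse n k) (collapse n j) \<in> OA n n"
      by (rule OA_compose[rotated])
    then show ?thesis using OA_subset by blast
  qed
  have "?a (collapse n k) ?y = ?a (compose {1..n} (collapse n k) (collapse n j)) ?y"
    using act_comp[OF n n n C(2) C(1) y(1)] y(2) by simp
  also have "\<dots> = ?a (compose {1..n} (collapse n j) (compose {1..n} (collapse n k) (collapse n j))) ?y"
    using collapse_absorb[of k j n] Suc.prems j by simp
  also have "\<dots> = ?a (collapse n j) (?a (collapse n k) ?y)"
    using act_comp[OF n n n OA C(2) y(1)] act_comp[OF n n n C(2) C(1) y(1)] y(2) by simp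
  finally have "?a (collapse n j) (?a (collapse n k) ?y) = ?a (collapse n k) ?y" by simp
  then show ?case
    using linear_map_minus[OF obj_module[OF n] obj_module[OF n] act_linear[OF n n C(2)] y(1) ey] y(2)
    by simp
qed

text \<open>Only smaller indices act before the factor of index j, so that factor still meets a
  vector fixed by \<open>collapse n j\<close> and returns 0; the later factors keep 0.\<close>

lemma conormalize_kills_fixed:
  assumes "j < k" "k + 1 \<le> n" and x: "x \<in> carrier (obj M n)"
    and fixed: "act M n n (collapse n j) x = x"
  shows "conormalize n k x = \<zero>\<^bsub>obj M n\<^esub>"
  using assms(1,2)
proof (induction k)
  case (Suc k)
  have n: "0 < n" using Suc.prems by simp
  interpret Mn: module R "obj M n" using obj_module n by blast
  show ?case
  proof (cases "k = j")
    case True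
    then have "act M n n (collapse n k) (conormalize n k x) = conormalize n k x"
      using conormalize_fixed[of k j n x] Suc.prems x fixed by simp
    then show ?thesis
      using conormalize_closed[of k n x] Suc.prems x by (simp add: a_minus_def Mn.M.r_neg)
  next
    case False
    then have "conormalize n k x = \<zero>\<^bsub>obj M n\<^esub>" using Suc by simp
    moreover have "act M n n (collapse n k) \<zero>\<^bsub>obj M n\<^esub> = \<zero>\<^bsub>obj M n\<^esub>"
      using linear_map_zero[OF Mn.module_axioms Mn.module_axioms act_linear[OF n n collapse_in]] Suc.prems by simp
    ultimately show ?thesis by (simp add: a_minus_def)
  qed
qed simp

lemma conormalize_kills_generator:
  assumes "d > 0" "d + 2 \<le> n" "v \<in> carrier (obj M d)" "h \<in> C d n"
  shows "conormalize n (n - 1) (act M d n h v) = \<zero>\<^bsub>obj M n\<^esub>"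
proof -
  have h: "h \<in> FA d n" using assms subset_FA by blast
  obtain j where j: "j + 2 \<le> n" "j + 2 \<notin> h ` {1..d}" using FA_misses[OF h assms(2)] by blast
  have "act M n n (collapse n j) (act M d n h v) = act M d n h v"
    using act_comp[of d n n h "collapse n j" v] collapse_fixes[OF h j(2)] collapse_in[OF j(1)] assms
    by simp
  then show ?thesis
    using conormalize_kills_fixed[of j "n - 1" n] act_closed[of d n h v] assms j by simp
qed

text \<open>Each factor subtracts a collapse of the current vector y, which passes through M(n - 1);
  there membership in N' is exchanged for membership in N. The first conjunct keeps y in N' so that
  this is possible.\<close>

lemma conormalize_congruent:
  assumes N: "cat_submodule R C M N" and N': "cat_submodule R C M N'"
    and le: "N' (n - 1) \<subseteq> N (n - 1)" and x: "x \<in> N' n" and "k + 1 \<le> n"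
  shows "conormalize n k x \<in> N' n \<and> x \<ominus>\<^bsub>obj M n\<^esub> conormalize n k x \<in> N n"
  using \<open>k + 1 \<le> n\<close>
proof (induction k)
  case 0
  then interpret Mn: module R "obj M n" using obj_module by simp
  have Nn: "submodule (N n) R (obj M n)" "submodule (N' n) R (obj M n)"
    using N N' 0 by (auto simp: cat_submodule_def)
  have "x \<ominus>\<^bsub>obj M n\<^esub> x = \<zero>\<^bsub>obj M n\<^esub>"
    using x Mn.submoduleE(1)[OF Nn(2)] by (auto simp: a_minus_def Mn.M.r_neg)
  then show ?case
    using x additive_subgroup.zero_closed[OF submodule_additive_subgroup[OF Nn(1)]] by simp
next
  case (Suc k)
  let ?y = "conormalize n k x"
  let ?ey = "act M n n (collapse n k) ?y"
  have n: "0 < n" "0 < n - 1" using Suc.prems by auto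
  interpret Mn: module R "obj M n" using obj_module n by simp
  have Nn: "submodule (N n) R (obj M n)" "submodule (N' n) R (obj M n)"
    using N N' n by (auto simp: cat_submodule_def)
  have y: "?y \<in> N' n" "x \<ominus>\<^bsub>obj M n\<^esub> ?y \<in> N n" using Suc by auto
  have carr: "x \<in> carrier (obj M n)" "?y \<in> carrier (obj M n)"
    using x y Mn.submoduleE(1)[OF Nn(2)] by auto
  have C: "coface n k \<in> C (n - 1) n" "codegeneracy n k \<in> C n (n - 1)" "collapse n k \<in> C n n"
    using Suc.prems coface_OA codegeneracy_OA collapse_OA OA_subset by (simp_all add: subset_iff)
  have "act M n (n - 1) (codegeneracy n k) ?y \<in> N (n - 1)"
    using N' n C(2) y(1) le unfolding cat_submodule_def by blast
  then have "act M (n - 1) n (coface n k) (act M n (n - 1) (codegeneracy n k) ?y) \<in> N n"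
    using N n C(1) unfolding cat_submodule_def by blast
  then have ey: "?ey \<in> N n"
    using act_comp[OF n(1) n(2) n(1) C(2) C(1) carr(2)] collapse_factor[of k n] Suc.prems by simp
  have ey': "?ey \<in> N' n" using N' n C(3) y(1) unfolding cat_submodule_def by blast
  have "?y \<ominus>\<^bsub>obj M n\<^esub> ?ey \<in> N' n"
    using y(1) ey' Mn.submoduleE(3,5)[OF Nn(2)] by (simp add: a_minus_def)
  moreover have "x \<ominus>\<^bsub>obj M n\<^esub> (?y \<ominus>\<^bsub>obj M n\<^esub> ?ey) = (x \<ominus>\<^bsub>obj M n\<^esub> ?y) \<oplus>\<^bsub>obj M n\<^esub> ?ey"
    using carr ey Mn.submoduleE(1)[OF Nn(1)]
    by (simp add: a_minus_def Mn.M.minus_add Mn.M.add.m_assoc subset_iff)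
  ultimately show ?case using y(2) ey Mn.submoduleE(5)[OF Nn(1)] by simp
qed

text \<open>Strong induction on n. The assumption \<open>gen\<close> expresses generation through
  submodules, so it applies to the kernel of \<open>conormalize\<close>: from degree D on the kernel
  contains all vectors h v_i, hence everything.\<close>

lemma submodules_determined:
  fixes r :: nat
  assumes d: "\<And>i. i < r \<Longrightarrow> d i > 0 \<and> d i + 2 \<le> D \<and> v i \<in> carrier (obj M (d i))"
    and gen: "\<And>n T. \<lbrakk>n > 0; submodule T R (obj M n); \<And>i h. i < r \<Longrightarrow> h \<in> C (d i) n \<Longrightarrow> act M (d i) n h (v i) \<in> T\<rbrakk>
      \<Longrightarrow> carrier (obj M n) \<subseteq> T"
    and D: "2 \<le> D" and N: "cat_submodule R C M N" "cat_submodule R C M N'"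
    and le: "\<And>n. 0 < n \<Longrightarrow> n < D \<Longrightarrow> N' n \<subseteq> N n"
  shows "sub_le N' N"
proof -
  have "N' n \<subseteq> N n" if "0 < n" for n
    using that
  proof (induction n rule: less_induct)
    case (less n)
    show ?case
    proof (cases "n < D")
      case False
      interpret Mn: module R "obj M n" using obj_module less by simp
      have Nn: "submodule (N n) R (obj M n)" "submodule (N' n) R (obj M n)"
        using N less by (auto simp: cat_submodule_def)
      have lin: "linear_map R (obj M n) (obj M n) (conormalize n (n - 1))"
        using less by (intro conormalize_linear) simp
      have "carrier (obj M n) \<subseteq> {x \<in> carrier (obj M n). conormalize n (n - 1) x = \<zero>\<^bsub>obj M n\<^esub>}"
      proof (rule gen[OF less.prems linear_map_kernel[OF Mn.module_axioms Mn.module_axioms lin]])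
        fix i h assume "i < r" "h \<in> C (d i) n"
        then show "act M (d i) n h (v i) \<in> {x \<in> carrier (obj M n). conormalize n (n - 1) x = \<zero>\<^bsub>obj M n\<^esub>}"
          using d[of i] False less.prems conormalize_kills_generator[of "d i" n "v i" h]
            act_closed[of "d i" n h "v i"] by simp
      qed
      then have zero: "conormalize n (n - 1) x = \<zero>\<^bsub>obj M n\<^esub>" if "x \<in> carrier (obj M n)" for x
        using that by blast
      \<comment> \<open>Since n \<ge> D \<ge> 2, the index n - 1 is still an object.\<close>
      have "N' (n - 1) \<subseteq> N (n - 1)" using less.IH[of "n - 1"] False D by simp
      then have "x \<ominus>\<^bsub>obj M n\<^esub> conormalize n (n - 1) x \<in> N n" if "x \<in> N' n" for x
        using conormalize_congruent[OF N, of n x "n - 1"] that less.prems by simp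
      moreover have "x \<ominus>\<^bsub>obj M n\<^esub> conormalize n (n - 1) x = x" if "x \<in> N' n" for x
        using that zero[of x] Mn.submoduleE(1)[OF Nn(2)] by (simp add: a_minus_def subset_iff)
      ultimately show ?thesis by (metis subsetI)
    qed (use le less in blast)
  qed
  then show ?thesis by (simp add: sub_le_def)
qed

section \<open>Generators as vectors of the module\<close>

lemma ring_cring: "cring R"
  using obj_module[of 1] by (simp add: module_def)

text \<open>Yoneda: a map out of the representable functor at d amounts to one vector, the image of
  the identity of [d]. Surjectivity turns into an induction principle for the submodules of each
  M(n).\<close>

lemma generators_exist:
  assumes fg: "finitely_generated R C M"
  obtains r :: nat and d :: "nat \<Rightarrow> nat" and v :: "nat \<Rightarrow> 'b"
  where "\<And>i. i < r \<Longrightarrow> d i > 0 \<and> v i \<in> carrier (obj M (d i))"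
    and "\<And>n T. \<lbrakk>n > 0; submodule T R (obj M n); \<And>i h. i < r \<Longrightarrow> h \<in> C (d i) n \<Longrightarrow> act M (d i) n h (v i) \<in> T\<rbrakk>
      \<Longrightarrow> carrier (obj M n) \<subseteq> T"
proof -
  interpret R: cring R by (rule ring_cring)
  from fg obtain r d \<pi> where d: "\<forall>i<r. d i > 0"
    and hom: "cat_module_hom R C (direct_sum r (\<lambda>i. representable R C (d i))) M \<pi>"
    and surj: "\<forall>n>0. \<pi> n ` carrier (obj (direct_sum r (\<lambda>i. representable R C (d i))) n) = carrier (obj M n)"
    unfolding finitely_generated_def by metis
  let ?P = "direct_sum r (\<lambda>i. representable R C (d i))"
  \<comment> \<open>The basis vector of the morphism h in summand i, in degree n.\<close>
  define e where "e n i h = (\<lambda>j\<in>{..<r}. \<lambda>h'\<in>C (d j) n. if j = i \<and> h' = h then \<one>\<^bsub>R\<^esub> else \<zero>\<^bsub>R\<^esub>)" for n i h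
  define v where "v i = \<pi> (d i) (e (d i) i (restrict id {1..d i}))" for i
  have carr: "carrier (obj ?P n) = (\<Pi>\<^sub>E i\<in>{..<r}. C (d i) n \<rightarrow>\<^sub>E carrier R)" for n
    by (simp add: direct_sum_def representable_def)
  have add: "x \<oplus>\<^bsub>obj ?P n\<^esub> y = (\<lambda>j\<in>{..<r}. \<lambda>h\<in>C (d j) n. x j h \<oplus>\<^bsub>R\<^esub> y j h)" for n x y
    by (simp add: direct_sum_def representable_def)
  have smult: "a \<odot>\<^bsub>obj ?P n\<^esub> x = (\<lambda>j\<in>{..<r}. \<lambda>h\<in>C (d j) n. a \<otimes>\<^bsub>R\<^esub> x j h)" for n a x
    by (simp add: direct_sum_def representable_def)
  have act: "act ?P m n g x = (\<lambda>j\<in>{..<r}. \<lambda>h\<in>C (d j) n.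
      \<Oplus>\<^bsub>R\<^esub>h'\<in>{h' \<in> C (d j) m. compose {1..d j} g h' = h}. x j h')" for m n g x
    by (simp add: direct_sum_def representable_def)
  have eta: "p = (\<lambda>j\<in>{..<r}. \<lambda>h\<in>C (d j) n. p j h)" if p: "p \<in> carrier (obj ?P n)" for n p
  proof
    fix j
    show "p j = (\<lambda>j\<in>{..<r}. \<lambda>h\<in>C (d j) n. p j h) j"
    proof (cases "j \<in> {..<r}")
      case True
      then have "p j \<in> C (d j) n \<rightarrow>\<^sub>E carrier R" using p[unfolded carr] by (rule PiE_mem[rotated])
      then show ?thesis using True extensional_restrict[of "p j" "C (d j) n"] by (simp add: PiE_def)
    next
      case False
      then show ?thesis using PiE_arb[OF p[unfolded carr]] by simp
    qed
  qed
  have lin: "linear_map R (obj ?P n) (obj M n) (\<pi> n)" if "n > 0" for n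
    using hom that unfolding cat_module_hom_def by blast
  have e_carr: "e n i h \<in> carrier (obj ?P n)" for n i h
    unfolding carr e_def by auto
  have id: "restrict id {1..d i} \<in> C (d i) (d i)" for i using id_in_OA OA_subset by blast
  \<comment> \<open>In the sum over the fibre of h'' under composition with h, only the identity in
    summand i has a nonzero coefficient, and it lies in that fibre exactly when h'' = h.\<close>
  have e_act: "act ?P (d i) n h (e (d i) i (restrict id {1..d i})) = e n i h"
    if i: "i < r" and h: "h \<in> C (d i) n" for n i h
    unfolding act e_def[of n]
  proof (intro restrict_ext)
    fix j h'' assume j: "j \<in> {..<r}" and h'': "h'' \<in> C (d j) n"
    let ?S = "{h' \<in> C (d j) (d i). compose {1..d j} h h' = h''}"
    have fin: "finite ?S" using finite_FA finite_subset[OF subset_FA] by simp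
    have "(\<Oplus>\<^bsub>R\<^esub>h'\<in>?S. e (d i) i (restrict id {1..d i}) j h') =
        (\<Oplus>\<^bsub>R\<^esub>h'\<in>?S. if j = i \<and> h' = restrict id {1..d i} then \<one>\<^bsub>R\<^esub> else \<zero>\<^bsub>R\<^esub>)"
      using j by (intro R.finsum_cong') (auto simp: e_def)
    also have "\<dots> = (if j = i \<and> h'' = h then \<one>\<^bsub>R\<^esub> else \<zero>\<^bsub>R\<^esub>)"
    proof (cases "j = i \<and> h'' = h")
      case True
      then have "restrict id {1..d i} \<in> ?S"
        using id[of i] compose_id_right[of h "d i" n] h subset_FA[of "d i" n] by (simp add: subset_iff)
      then have "(\<Oplus>\<^bsub>R\<^esub>h'\<in>?S. if restrict id {1..d i} = h' then \<one>\<^bsub>R\<^esub> else \<zero>\<^bsub>R\<^esub>) = \<one>\<^bsub>R\<^esub>"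
        using R.add.finprod_singleton[of "restrict id {1..d i}" ?S "\<lambda>_. \<one>\<^bsub>R\<^esub>"] fin by simp
      moreover have "(\<Oplus>\<^bsub>R\<^esub>h'\<in>?S. if j = i \<and> h' = restrict id {1..d i} then \<one>\<^bsub>R\<^esub> else \<zero>\<^bsub>R\<^esub>) =
          (\<Oplus>\<^bsub>R\<^esub>h'\<in>?S. if restrict id {1..d i} = h' then \<one>\<^bsub>R\<^esub> else \<zero>\<^bsub>R\<^esub>)"
        using True by (intro R.finsum_cong') auto
      ultimately show ?thesis using True by simp
    next
      case False
      have "\<not> (j = i \<and> h' = restrict id {1..d i})" if "h' \<in> ?S" for h'
      proof
        assume "j = i \<and> h' = restrict id {1..d i}"
        then have "j = i" "h'' = h"
          using that compose_id_right[of h "d i" n] h subset_FA[of "d i" n] by (auto simp: subset_iff)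
        then show False using False by simp
      qed
      then have "(\<Oplus>\<^bsub>R\<^esub>h'\<in>?S. if j = i \<and> h' = restrict id {1..d i} then \<one>\<^bsub>R\<^esub> else \<zero>\<^bsub>R\<^esub>) =
          (\<Oplus>\<^bsub>R\<^esub>h'\<in>?S. \<zero>\<^bsub>R\<^esub>)"
        by (intro R.finsum_cong') auto
      then show ?thesis using False by auto
    qed
    finally show "(\<Oplus>\<^bsub>R\<^esub>h'\<in>?S. e (d i) i (restrict id {1..d i}) j h') =
        (if j = i \<and> h'' = h then \<one>\<^bsub>R\<^esub> else \<zero>\<^bsub>R\<^esub>)" .
  qed
  show ?thesis
  proof (rule that[of r d v])
    show "d i > 0 \<and> v i \<in> carrier (obj M (d i))" if "i < r" for i
      using that d linear_map_closed[OF lin e_carr] by (simp add: v_def)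
  next
    fix n T
    assume n: "0 < n" and T: "submodule T R (obj M n)"
      and gen: "\<And>i h. i < r \<Longrightarrow> h \<in> C (d i) n \<Longrightarrow> act M (d i) n h (v i) \<in> T"
    interpret Mn: module R "obj M n" by (rule obj_module[OF n])
    have basis: "\<pi> n (e n i h) \<in> T" if i: "i < r" and h: "h \<in> C (d i) n" for i h
    proof -
      have "\<pi> n (act ?P (d i) n h (e (d i) i (restrict id {1..d i}))) = act M (d i) n h (v i)"
        using hom d i h n e_carr unfolding cat_module_hom_def v_def by simp
      then show ?thesis using e_act[OF i h] gen[OF i h] by simp
    qed
    \<comment> \<open>F contains the support of p; removing a pair from F splits off one multiple of
      a basis vector.\<close>
    have support: "\<pi> n p \<in> T"
      if "finite F" "p \<in> carrier (obj ?P n)"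
        "\<And>j h. j < r \<Longrightarrow> h \<in> C (d j) n \<Longrightarrow> (j, h) \<notin> F \<Longrightarrow> p j h = \<zero>\<^bsub>R\<^esub>" for F p
      using that
    proof (induction F arbitrary: p)
      case empty
      \<comment> \<open>The direct sum has not been shown to be a module, so its zero vector is
        treated as the multiple 0 p, which every \<open>linear_map\<close> respects.\<close>
      have "(\<lambda>j\<in>{..<r}. \<lambda>h\<in>C (d j) n. p j h) = \<zero>\<^bsub>R\<^esub> \<odot>\<^bsub>obj ?P n\<^esub> p"
        unfolding smult using empty(2) by (intro restrict_ext) simp
      then have "\<pi> n p = \<pi> n (\<zero>\<^bsub>R\<^esub> \<odot>\<^bsub>obj ?P n\<^esub> p)"
        by (rule arg_cong[OF trans[OF eta[OF empty(1)]]])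
      also have "\<dots> = \<zero>\<^bsub>R\<^esub> \<odot>\<^bsub>obj M n\<^esub> \<pi> n p"
        by (rule linear_map_smult[OF lin[OF n] R.zero_closed empty(1)])
      also have "\<dots> = \<zero>\<^bsub>obj M n\<^esub>"
        using linear_map_closed[OF lin[OF n] empty(1)] by simp
      finally show ?case
        using additive_subgroup.zero_closed[OF submodule_additive_subgroup[OF T]] by simp
    next
      case (insert ih F)
      obtain i h where ih: "ih = (i, h)" by (cases ih)
      show ?case
      proof (cases "i < r \<and> h \<in> C (d i) n")
        case True
        define p' where "p' = (\<lambda>j\<in>{..<r}. \<lambda>h'\<in>C (d j) n. if j = i \<and> h' = h then \<zero>\<^bsub>R\<^esub> else p j h')"
        have val: "p j h' \<in> carrier R" if "j < r" "h' \<in> C (d j) n" for j h'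
          using insert.prems(1) that unfolding carr by (auto simp: PiE_iff)
        have p': "p' \<in> carrier (obj ?P n)" unfolding carr p'_def using val by auto
        have pe: "p i h \<odot>\<^bsub>obj ?P n\<^esub> e n i h \<in> carrier (obj ?P n)"
          unfolding smult carr e_def using val True by auto
        have coeff: "p i h \<in> carrier R" using val True by simp
        have T': "\<pi> n p' \<in> T"
          using insert.prems(2) ih by (intro insert.IH[OF p']) (auto simp: p'_def)
        have "(\<lambda>j\<in>{..<r}. \<lambda>h\<in>C (d j) n. p j h) =
            p' \<oplus>\<^bsub>obj ?P n\<^esub> (p i h \<odot>\<^bsub>obj ?P n\<^esub> e n i h)"
          unfolding add smult
        proof (intro restrict_ext)
          fix j h' assume "j \<in> {..<r}" "h' \<in> C (d j) n"
          then show "p j h' = p' j h' \<oplus>\<^bsub>R\<^esub> (\<lambda>j\<in>{..<r}. \<lambda>h'\<in>C (d j) n. p i h \<otimes>\<^bsub>R\<^esub> e n i h j h') j h'"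
            using coeff val[of j h'] by (simp add: p'_def e_def)
        qed
        then have "\<pi> n p = \<pi> n (p' \<oplus>\<^bsub>obj ?P n\<^esub> (p i h \<odot>\<^bsub>obj ?P n\<^esub> e n i h))"
          by (rule arg_cong[OF trans[OF eta[OF insert.prems(1)]]])
        also have "\<dots> = \<pi> n p' \<oplus>\<^bsub>obj M n\<^esub> p i h \<odot>\<^bsub>obj M n\<^esub> \<pi> n (e n i h)"
          using linear_map_add[OF lin[OF n] p' pe] linear_map_smult[OF lin[OF n] coeff e_carr] by simp
        also have "\<dots> \<in> T"
          using Mn.submoduleE(4,5)[OF T] T' basis[of i h] coeff True by blast
        finally show ?thesis .
      next
        case False
        then show ?thesis using insert.prems ih by (intro insert.IH) auto
      qed
    qed
    show "carrier (obj M n) \<subseteq> T"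
    proof
      fix x assume "x \<in> carrier (obj M n)"
      then obtain p where p: "p \<in> carrier (obj ?P n)" "x = \<pi> n p" using surj n by blast
      have "finite (SIGMA j:{..<r}. C (d j) n)"
        using finite_FA finite_subset[OF subset_FA] by blast
      then show "x \<in> T" unfolding p(2) by (rule support[OF _ p(1)]) auto
    qed
  qed
qed

section \<open>Chains of submodules and the two conclusions\<close>

lemma bounded_family_submodule_chains:
  assumes short: "short_interval u {I. ideal I R} {\<zero>\<^bsub>R\<^esub>} (carrier R)"
    and fg: "finitely_generated R C M"
  shows "bounded_family u ((\<lambda>N. {i. \<not> sub_le (N (Suc i)) (N i)}) `
    {N. (\<forall>i. cat_submodule R C M (N i)) \<and> (\<forall>i. sub_le (N i) (N (Suc i)))})"
proof -
  obtain r :: nat and d v where d: "\<And>i. i < r \<Longrightarrow> d i > 0 \<and> v i \<in> carrier (obj M (d i))"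
    and gen: "\<And>n T. \<lbrakk>n > 0; submodule T R (obj M n); \<And>i h. i < r \<Longrightarrow> h \<in> C (d i) n \<Longrightarrow> act M (d i) n h (v i) \<in> T\<rbrakk>
      \<Longrightarrow> carrier (obj M n) \<subseteq> T"
    by (rule generators_exist[OF fg]) blast
  \<comment> \<open>A common bound for all d i + 2; the sum also covers r = 0, where D = 2.\<close>
  define D where "D = (\<Sum>i<r. d i) + 2"
  have D: "d i + 2 \<le> D" if "i < r" for i
    unfolding D_def using that member_le_sum[of i "{..<r}" d] by auto
  let ?F = "\<lambda>n. strict_steps ` {N. incseq N \<and> (\<forall>i. N i \<in> {T. submodule T R (obj M n)} \<and>
      {\<zero>\<^bsub>obj M n\<^esub>} \<subseteq> N i \<and> N i \<subseteq> carrier (obj M n))}"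
  show ?thesis
  proof (rule bounded_family_UN[of "{0<..<D}" u ?F])
    fix n assume "n \<in> {0<..<D}"
    then have n: "0 < n" by simp
    interpret Mn: module R "obj M n" by (rule obj_module[OF n])
    \<comment> \<open>Finite because there are only finitely many morphisms from [d i] to [n]; so
      M(n) is a finitely generated module.\<close>
    define G where "G = (\<lambda>(i, h). act M (d i) n h (v i)) ` (SIGMA i:{..<r}. C (d i) n)"
    have "finite G"
      unfolding G_def using finite_FA finite_subset[OF subset_FA] by blast
    moreover have "G \<subseteq> carrier (obj M n)"
      unfolding G_def using d act_closed n by auto
    moreover have "carrier (obj M n) \<subseteq> T" if "submodule T R (obj M n)" "G \<subseteq> T" for T
      using gen[OF n that(1)] that(2) unfolding G_def by (auto simp: subset_iff image_iff)
    ultimately show "bounded_family u (?F n)"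
      using Mn.short_interval_finitely_generated[OF short, of G] unfolding short_interval_def by blast
  next
    fix S assume "S \<in> (\<lambda>N. {i. \<not> sub_le (N (Suc i)) (N i)}) `
      {N. (\<forall>i. cat_submodule R C M (N i)) \<and> (\<forall>i. sub_le (N i) (N (Suc i)))}"
    then obtain N where N: "\<And>i. cat_submodule R C M (N i)" "\<And>i. sub_le (N i) (N (Suc i))"
      and S: "S = {i. \<not> sub_le (N (Suc i)) (N i)}" by blast
    let ?s = "\<lambda>n. strict_steps (\<lambda>i. N i n)"
    have "?s n \<in> ?F n" if "n \<in> {0<..<D}" for n
    proof (intro imageI CollectI conjI allI)
      have n: "0 < n" using that by simp
      show "incseq (\<lambda>i. N i n)" using N(2) n by (intro incseq_SucI) (simp add: sub_le_def)
      fix i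
      have sub: "submodule (N i n) R (obj M n)" using N(1) n by (simp add: cat_submodule_def)
      show "submodule (N i n) R (obj M n)" by (rule sub)
      show "{\<zero>\<^bsub>obj M n\<^esub>} \<subseteq> N i n"
        using additive_subgroup.zero_closed[OF submodule_additive_subgroup[OF sub]] by simp
      show "N i n \<subseteq> carrier (obj M n)" by (rule module.submoduleE(1)[OF obj_module[OF n] sub])
    qed
    \<comment> \<open>A step that is strict in no degree 0 < n < D would, by
      \<open>submodules_determined\<close>, not be strict at all.\<close>
    moreover have "i \<in> (\<Union>n\<in>{0<..<D}. ?s n)" if "i \<in> S" for i
    proof (rule ccontr)
      assume "i \<notin> (\<Union>n\<in>{0<..<D}. ?s n)"
      then have le: "N (Suc i) n \<subseteq> N i n" if "0 < n" "n < D" for n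
        using that unfolding strict_steps_def by fastforce
      have "sub_le (N (Suc i)) (N i)"
      proof (rule submodules_determined[where r = r and d = d and v = v and D = D])
        show "d j > 0 \<and> d j + 2 \<le> D \<and> v j \<in> carrier (obj M (d j))" if "j < r" for j
          using d[OF that] D[OF that] by simp
        show "carrier (obj M n) \<subseteq> T"
          if "0 < n" "submodule T R (obj M n)" "\<And>i h. i < r \<Longrightarrow> h \<in> C (d i) n \<Longrightarrow> act M (d i) n h (v i) \<in> T" for n T
          using that by (rule gen)
        show "N (Suc i) n \<subseteq> N i n" if "0 < n" "n < D" for n using that by (rule le)
      qed (use N(1) in \<open>simp_all add: D_def\<close>)
      then show False using that S by simp
    qed
    ultimately show "\<exists>s. (\<forall>n\<in>{0<..<D}. s n \<in> ?F n) \<and> S \<subseteq> (\<Union>n\<in>{0<..<D}. s n)"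
      by (intro exI[of _ ?s]) blast
  qed simp
qed

lemma sub_le_chain:
  assumes "\<And>j. i \<le> j \<Longrightarrow> j < k \<Longrightarrow> sub_le (N (Suc j)) (N j)" "i \<le> k"
  shows "sub_le (N k) (N i)"
  using assms(2,1)
proof (induction k rule: dec_induct)
  case (step k)
  then have "sub_le (N k) (N i)" "sub_le (N (Suc k)) (N k)" by auto
  then show ?case unfolding sub_le_def by (meson subset_trans)
qed (simp add: sub_le_def)

lemma noetherian_if_short:
  assumes "short_interval False {I. ideal I R} {\<zero>\<^bsub>R\<^esub>} (carrier R)" "finitely_generated R C M"
  shows "noetherian_module R C M"
  unfolding noetherian_module_def
proof (intro allI impI, elim conjE)
  fix N assume "\<forall>i. cat_submodule R C M (N i)" "\<forall>i. sub_le (N i) (N (Suc i))"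
  then have "finite {i. \<not> sub_le (N (Suc i)) (N i)}"
    using bounded_family_submodule_chains[OF assms] unfolding bounded_family_def by blast
  then obtain i0 where i0: "{i. \<not> sub_le (N (Suc i)) (N i)} \<subseteq> {..<i0}"
    using finite_nat_bounded by blast
  have "sub_le (N (Suc i)) (N i)" if "i0 \<le> i" for i
  proof (rule ccontr)
    assume "\<not> sub_le (N (Suc i)) (N i)"
    then have "i \<in> {..<i0}" using i0 by blast
    then show False using that by simp
  qed
  then show "\<exists>i0. \<forall>i\<ge>i0. sub_le (N i) (N i0)"
    using sub_le_chain[of i0 _ N] by blast
qed

lemma finite_length_if_short:
  assumes "short_interval True {I. ideal I R} {\<zero>\<^bsub>R\<^esub>} (carrier R)" "finitely_generated R C M"
  shows "finite_length R C M"
proof -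
  define F where "F = (\<lambda>N. {i. \<not> sub_le (N (Suc i)) (N i)}) `
    {N. (\<forall>i. cat_submodule R C M (N i)) \<and> (\<forall>i. sub_le (N i) (N (Suc i)))}"
  have "bounded_family True F"
    unfolding F_def by (rule bounded_family_submodule_chains[OF assms])
  then obtain L where F: "\<And>S. S \<in> F \<Longrightarrow> finite S \<and> card S \<le> L"
    unfolding bounded_family_def by blast
  have "l \<le> L" if N: "\<forall>i\<le>l. cat_submodule R C M (N i)"
    "\<forall>i<l. sub_le (N i) (N (Suc i)) \<and> \<not> sub_le (N (Suc i)) (N i)" for l N
  proof -
    \<comment> \<open>The finite chain is prolonged by its last term, and its l strict steps
      survive.\<close>
    let ?N = "\<lambda>i. N (min i l)"
    let ?S = "{i. \<not> sub_le (?N (Suc i)) (?N i)}"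
    have "sub_le (?N i) (?N (Suc i))" for i
    proof (cases "i < l")
      case True
      then show ?thesis using N(2) by simp
    next
      case False
      then show ?thesis by (simp add: sub_le_def)
    qed
    moreover have "cat_submodule R C M (?N i)" for i using N(1) by simp
    ultimately have "?S \<in> F" unfolding F_def by (intro image_eqI[of _ _ ?N]) auto
    then have "finite ?S" "card ?S \<le> L" using F by auto
    moreover have "{..<l} \<subseteq> ?S" using N(2) by auto
    ultimately show ?thesis using card_mono[of ?S "{..<l}"] by simp
  qed
  then show ?thesis unfolding finite_length_def by blast
qed

end

theorem corollary1p3:
  fixes R :: "('a, 'r) ring_scheme" and C :: category
  assumes "cring R" and "C \<in> {FA, OA, CA, BA, SA}"
  shows "(noetherian_ring R \<longrightarrow>
            (\<forall>M :: ('a, 'b) cat_functor.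
               cat_module R C M \<and> finitely_generated R C M \<longrightarrow> noetherian_module R C M)) \<and>
         (artinian_ring R \<longrightarrow>
            (\<forall>M :: ('a, 'b) cat_functor.
               cat_module R C M \<and> finitely_generated R C M \<longrightarrow> finite_length R C M))"
proof (intro conjI impI allI; elim conjE)
  fix M :: "('a, 'b) cat_functor"
  assume M: "cat_module R C M" "finitely_generated R C M"
  have over: "module_over_OA R C M"
    using M(1) OA_subset_category[OF assms(2)] category_subset_FA[OF assms(2)]
    by (simp add: module_over_OA_def module_over_OA_axioms_def)
  show "noetherian_module R C M" if "noetherian_ring R"
    using module_over_OA.noetherian_if_short[OF over noetherian_ring.short_interval_ideals[OF that] M(2)] .
  show "finite_length R C M" if "artinian_ring R"
    using module_over_OA.finite_length_if_short[OF over artinian_cring.short_interval_carrier M(2)]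
      artinian_cring.intro[OF that assms(1)] by simp
qed

end
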